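(* Let $U=(U_{ij}:i,j\in I)$ be an ultrametric matrix satisfying (H1)–(H4), the chain $\widetilde X$ of its minimal tree matrix extension being transient, and let $Q$ be the matrix on $I\times I$ given by $$Q_{ij}=\widetilde Q_{ij}+\sum_{\tilde k\in\widetilde I\setminus I}\widetilde Q_{i\tilde k}\,\mathbb P_{\tilde k}(\widetilde X_\tau=j).$$ Given a bounded $Q$-harmonic function $h$ defined on $I$, there exists a unique $\widetilde Q$-harmonic function $\tilde h$ defined on $\widetilde I$ which is an extension of $h$.
   Context: Ultrametric matrix. $I$ is countable; $U$ is real, symmetric and satisfies $U_{ij}\ge\min\{U_{ik},U_{kj}\}$ for all $i,j,k\in I$. (H1): if $i\ne j$ then $U_{ik}\ne U_{jk}$ for some $k\in I$. (H2): $\mathcal W=\{U_{ij}:i,j\in I\}\subset(0,\infty)$ has no finite accumulation point; write $\mathcal W=\{w_n:n\in\mathbb N\}$ with $0<w_0<w_1<\cdots$, and $w_{-1}=0$. For $w\in\mathcal W$ let $J(w)=\{i\in I:U_{ii}\ge w\}$, and for $i,j\in J(w)$ put $i\equiv_wj$ iff $U_{ij}\ge w$ (an equivalence relation on $J(w)$); $E^w$ denotes an equivalence class and $E^w_i$ the class of $i$. (H3): for every $w\in\mathcal W$ the number of equivalence classes of $\equiv_w$ in $J(w)$ is finite. Minimal tree extension. $\widetilde I=\{(E^w,w): E^w\in J(w)/\!\equiv_w,\ w\in\mathcal W\}$; $I$ is identified with a subset of $\widetilde I$ via the injection $i\mapsto(E^{U_{ii}}_i,U_{ii})$. Two points $(E^u,u),(E^v,v)$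 are neighbours, i.e. linked in $\widetilde{\mathcal T}$, iff $\{u,v\}=\{w_n,w_{n+1}\}$ for some $n$ and $E^u\cap E^v\ne\emptyset$. Then $(\widetilde I,\widetilde{\mathcal T})$ is a locally finite tree, rooted at the unique point $\tilde r$ with second coordinate $w_0$; $(E^{w_n},w_n)$ has level $n$. Write $|\tilde\imath|$ for the level, $\tilde\imath^-$ for the predecessor ($\tilde\imath\neq\tilde r$), $S_{\tilde\imath}$ for the set of successors. The $q$-matrix of the extension is $\widetilde Q_{\tilde\imath\tilde\imath^-}=\widetilde Q_{\tilde\imath^-\tilde\imath}=(w_{|\tilde\imath|}-w_{|\tilde\imath|-1})^{-1}$ for $\tilde\imath\ne\tilde r$, $\widetilde Q_{\tilde\imath\tilde\imath}=-\big((w_{|\tilde\imath|}-w_{|\tilde\imath|-1})^{-1}+|S_{\tilde\imath}|(w_{|\tilde\imath|+1}-w_{|\tilde\imath|})^{-1}\big)$, and $0$ otherwise. Chain. $\widetilde X$ is the minimal continuous-time Markov chain on $\widetilde I$ with $q$-matrix $\widetilde Q$, absorbed from $\tilde r$ at rate $1/w_0$ in an extra state $\partial_{\tilde r}$; $\tilde\zeta$ is its lifetime. When not absorbed it converges a.s., as $t\uparrow\tilde\zeta$, to a point of the boundary $\widetilde\partial_\infty$ (the set of infinite rays of $\widetilde I$ from $\tilde r$). $\widetilde X$ is assumed transient: from $\tilde r$ it has positive probability of ending in $\widetilde\partial_\infty$. Let $\tau=\inf\{t>0:\widetilde X_t\in I\cup\{\partial_{\tilde r}\}\}\wedge\tilde\zeta$.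 (H4): for all $\tilde\jmath\in\widetilde I\setminus I$, $\mathbb P_{\tilde\jmath}\{\widetilde X_\tau\in I\cup\{\partial_{\tilde r}\}\}=1$. Harmonicity. $h:I\to\mathbb R$ is $Q$-harmonic if $\sum_{j\in I}Q_{ij}h(j)=0$ for all $i\in I$; $\tilde h:\widetilde I\to\mathbb R$ is $\widetilde Q$-harmonic if $\sum_{\tilde\jmath\in\widetilde I}\widetilde Q_{\tilde\imath\tilde\jmath}\tilde h(\tilde\jmath)=0$ for all $\tilde\imath\in\widetilde I$.
   Formalization: The extension is shown to be bounded and unique among bounded Q~-harmonic extensions of h; uniqueness among all, possibly unbounded, Q~-harmonic extensions is false in general (already for h = 0 on some trees satisfying (H1)–(H4) with transient chain). *)

theory Defs
  imports "HOL-Probability.Probability"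
begin

section \<open>The minimal continuous-time Markov chain of a q-matrix\<close>

text \<open>
  The chain is built from its jump chain and holding times. A sample point is a stream of pairs
  \<open>(f\<^sub>n, e\<^sub>n)\<close>: the \<open>n\<close>-th jump goes from the current state \<open>x\<close> to \<open>f\<^sub>n x\<close>, where the \<open>f\<^sub>n x\<close>
  are independent with law \<open>jump_prob q x\<close>, and the \<open>e\<^sub>n\<close> are independent unit exponentials, so that
  \<open>e\<^sub>n\<close> divided by the exit rate is the holding time. The same probability space serves all starting
  points. The intended \<open>q\<close> are conservative on the countable state space \<open>S\<close>.
\<close>

definition jump_prob :: "('s \<Rightarrow> 's \<Rightarrow> real) \<Rightarrow> 's \<Rightarrow> 's \<Rightarrow> real" where
  "jump_prob q x y =
     (if q x x = 0 then of_bool (x = y) else if x = y then 0 else q x y / (- q x x))"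

definition chain_space :: "'s set \<Rightarrow> ('s \<Rightarrow> 's \<Rightarrow> real) \<Rightarrow> (('s \<Rightarrow> 's) \<times> real) stream measure" where
  "chain_space S q = stream_space
     (PiM S (\<lambda>x. point_measure S (\<lambda>y. ennreal (jump_prob q x y)))
        \<Otimes>\<^sub>M density lborel (\<lambda>t. ennreal (exponential_density 1 t)))"

primrec jump_chain :: "'s \<Rightarrow> (('s \<Rightarrow> 's) \<times> real) stream \<Rightarrow> nat \<Rightarrow> 's" where
  "jump_chain x \<omega> 0 = x"
| "jump_chain x \<omega> (Suc n) = fst (\<omega> !! n) (jump_chain x \<omega> n)"

text \<open>In a state of exit rate \<open>0\<close> the holding time is infinite, as \<open>a / 0 = \<infinity>\<close> for \<open>a > 0\<close> in
  the type \<^typ>\<open>ennreal\<close>.\<close>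

definition holding_time ::
    "('s \<Rightarrow> 's \<Rightarrow> real) \<Rightarrow> 's \<Rightarrow> (('s \<Rightarrow> 's) \<times> real) stream \<Rightarrow> nat \<Rightarrow> ennreal" where
  "holding_time q x \<omega> n =
     ennreal (snd (\<omega> !! n)) / ennreal (- q (jump_chain x \<omega> n) (jump_chain x \<omega> n))"

definition jump_time ::
    "('s \<Rightarrow> 's \<Rightarrow> real) \<Rightarrow> 's \<Rightarrow> (('s \<Rightarrow> 's) \<times> real) stream \<Rightarrow> nat \<Rightarrow> ennreal" where
  "jump_time q x \<omega> n = (\<Sum>k<n. holding_time q x \<omega> k)"

definition lifetime ::
    "('s \<Rightarrow> 's \<Rightarrow> real) \<Rightarrow> 's \<Rightarrow> (('s \<Rightarrow> 's) \<times> real) stream \<Rightarrow> ennreal" where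
  "lifetime q x \<omega> = (SUP n. jump_time q x \<omega> n)"

text \<open>The state at time \<open>t\<close>; \<^const>\<open>None\<close> from the lifetime (explosion time) on.\<close>

definition chain_at ::
    "('s \<Rightarrow> 's \<Rightarrow> real) \<Rightarrow> 's \<Rightarrow> (('s \<Rightarrow> 's) \<times> real) stream \<Rightarrow> ennreal \<Rightarrow> 's option" where
  "chain_at q x \<omega> t =
     (if \<exists>n. jump_time q x \<omega> n \<le> t \<and> t < jump_time q x \<omega> (Suc n)
      then Some (jump_chain x \<omega> (LEAST n. jump_time q x \<omega> n \<le> t \<and> t < jump_time q x \<omega> (Suc n)))
      else None)"

definition hit_time ::
    "('s \<Rightarrow> 's \<Rightarrow> real) \<Rightarrow> 's set \<Rightarrow> 's \<Rightarrow> (('s \<Rightarrow> 's) \<times> real) stream \<Rightarrow> ennreal" where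
  "hit_time q A x \<omega> = min (Inf {t. 0 < t \<and> chain_at q x \<omega> t \<in> Some ` A}) (lifetime q x \<omega>)"

text \<open>The use of \<open>has_sum\<close> includes (absolute) convergence of the sums. Harmonic functions may be
  unbounded; a bounded harmonic function on \<open>I\<close> can have several harmonic extensions to the tree,
  of which exactly one is bounded, so uniqueness has to be claimed among bounded functions.\<close>

definition harmonic_on :: "'s set \<Rightarrow> ('s \<Rightarrow> 's \<Rightarrow> real) \<Rightarrow> ('s \<Rightarrow> real) \<Rightarrow> bool" where
  "harmonic_on A q h \<longleftrightarrow> (\<forall>i\<in>A. ((\<lambda>j. q i j * h j) has_sum 0) A)"


section \<open>Ultrametric matrices and their minimal tree extension\<close>

definition ultrametric_matrix :: "'a set \<Rightarrow> ('a \<Rightarrow> 'a \<Rightarrow> real) \<Rightarrow> bool" where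
  "ultrametric_matrix I U \<longleftrightarrow> countable I \<and> (\<forall>i\<in>I. \<forall>j\<in>I. U i j = U j i) \<and>
     (\<forall>i\<in>I. \<forall>j\<in>I. \<forall>k\<in>I. U i j \<ge> min (U i k) (U k j))"

definition matrix_values :: "'a set \<Rightarrow> ('a \<Rightarrow> 'a \<Rightarrow> real) \<Rightarrow> real set" where
  "matrix_values I U = {U i j |i j. i \<in> I \<and> j \<in> I}"

definition J_set :: "'a set \<Rightarrow> ('a \<Rightarrow> 'a \<Rightarrow> real) \<Rightarrow> real \<Rightarrow> 'a set" where
  "J_set I U v = {i \<in> I. U i i \<ge> v}"

definition J_rel :: "'a set \<Rightarrow> ('a \<Rightarrow> 'a \<Rightarrow> real) \<Rightarrow> real \<Rightarrow> ('a \<times> 'a) set" where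
  "J_rel I U v = {(i, j). i \<in> J_set I U v \<and> j \<in> J_set I U v \<and> U i j \<ge> v}"

type_synonym 'a vertex = "'a set \<times> real"

definition tree_ext :: "'a set \<Rightarrow> ('a \<Rightarrow> 'a \<Rightarrow> real) \<Rightarrow> 'a vertex set" where
  "tree_ext I U = {(E, v). v \<in> matrix_values I U \<and> E \<in> J_set I U v // J_rel I U v}"

text \<open>The identification of \<open>I\<close> with a set of points of the tree.\<close>

definition vertex_of :: "'a set \<Rightarrow> ('a \<Rightarrow> 'a \<Rightarrow> real) \<Rightarrow> 'a \<Rightarrow> 'a vertex" where
  "vertex_of I U i = (J_rel I U (U i i) `` {i}, U i i)"

text \<open>Below, \<open>w\<close> is the increasing enumeration of \<^term>\<open>matrix_values I U\<close>.\<close>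

definition linked :: "(nat \<Rightarrow> real) \<Rightarrow> 'a vertex \<Rightarrow> 'a vertex \<Rightarrow> bool" where
  "linked w x y \<longleftrightarrow> (\<exists>n. {snd x, snd y} = {w n, w (Suc n)}) \<and> fst x \<inter> fst y \<noteq> {}"

definition level :: "(nat \<Rightarrow> real) \<Rightarrow> 'a vertex \<Rightarrow> nat" where
  "level w x = (THE n. w n = snd x)"

definition root :: "'a set \<Rightarrow> ('a \<Rightarrow> 'a \<Rightarrow> real) \<Rightarrow> (nat \<Rightarrow> real) \<Rightarrow> 'a vertex" where
  "root I U w = (THE x. x \<in> tree_ext I U \<and> snd x = w 0)"

definition succs :: "'a set \<Rightarrow> ('a \<Rightarrow> 'a \<Rightarrow> real) \<Rightarrow> (nat \<Rightarrow> real) \<Rightarrow> 'a vertex \<Rightarrow> 'a vertex set" where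
  "succs I U w x = {y \<in> tree_ext I U. linked w x y \<and> level w y = Suc (level w x)}"

text \<open>The increment \<open>w\<^sub>n - w\<^sub>n\<^sub>-\<^sub>1\<close>, with \<open>w\<^sub>-\<^sub>1 = 0\<close>.\<close>

definition gap :: "(nat \<Rightarrow> real) \<Rightarrow> nat \<Rightarrow> real" where
  "gap w n = w n - (case n of 0 \<Rightarrow> 0 | Suc m \<Rightarrow> w m)"

text \<open>Here \<open>x\<close> is the predecessor of \<open>y\<close> iff \<open>y\<close> is a successor of \<open>x\<close>.\<close>

definition Q_ext ::
    "'a set \<Rightarrow> ('a \<Rightarrow> 'a \<Rightarrow> real) \<Rightarrow> (nat \<Rightarrow> real) \<Rightarrow> 'a vertex \<Rightarrow> 'a vertex \<Rightarrow> real" where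
  "Q_ext I U w x y =
     (if y \<in> succs I U w x then inverse (gap w (level w y))
      else if x \<in> succs I U w y then inverse (gap w (level w x))
      else if x = y then - (inverse (gap w (level w x))
                            + real (card (succs I U w x)) * inverse (gap w (Suc (level w x))))
      else 0)"


section \<open>The chain on the tree extension\<close>

datatype 'v state = Site 'v | Absorbed

definition chain_states :: "'a set \<Rightarrow> ('a \<Rightarrow> 'a \<Rightarrow> real) \<Rightarrow> 'a vertex state set" where
  "chain_states I U = insert Absorbed (Site ` tree_ext I U)"

text \<open>\<^const>\<open>Q_ext\<close> made conservative: the missing mass \<open>1 / w\<^sub>0\<close> at the root is the absorption rate.\<close>

fun chain_q :: "'a set \<Rightarrow> ('a \<Rightarrow> 'a \<Rightarrow> real) \<Rightarrow> (nat \<Rightarrow> real)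
    \<Rightarrow> 'a vertex state \<Rightarrow> 'a vertex state \<Rightarrow> real" where
  "chain_q I U w (Site x) (Site y) = Q_ext I U w x y"
| "chain_q I U w (Site x) Absorbed = (if x = root I U w then 1 / w 0 else 0)"
| "chain_q I U w Absorbed y = 0"

abbreviation tree_chain_space :: "'a set \<Rightarrow> ('a \<Rightarrow> 'a \<Rightarrow> real) \<Rightarrow> (nat \<Rightarrow> real)
    \<Rightarrow> (('a vertex state \<Rightarrow> 'a vertex state) \<times> real) stream measure" where
  "tree_chain_space I U w \<equiv> chain_space (chain_states I U) (chain_q I U w)"

text \<open>The state at the hitting time of \<open>I \<union> {\<partial>}\<close>, for the chain started from \<open>x\<close>; it is
  \<^const>\<open>None\<close> if this set is not hit before the lifetime.\<close>

definition chain_at_tau :: "'a set \<Rightarrow> ('a \<Rightarrow> 'a \<Rightarrow> real) \<Rightarrow> (nat \<Rightarrow> real) \<Rightarrow> 'a vertex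
    \<Rightarrow> (('a vertex state \<Rightarrow> 'a vertex state) \<times> real) stream \<Rightarrow> 'a vertex state option" where
  "chain_at_tau I U w x \<omega> =
     chain_at (chain_q I U w) (Site x) \<omega>
       (hit_time (chain_q I U w) (insert Absorbed (Site ` vertex_of I U ` I)) (Site x) \<omega>)"

definition rays :: "'a set \<Rightarrow> ('a \<Rightarrow> 'a \<Rightarrow> real) \<Rightarrow> (nat \<Rightarrow> real) \<Rightarrow> (nat \<Rightarrow> 'a vertex) set" where
  "rays I U w = {\<rho>. \<rho> 0 = root I U w \<and> (\<forall>n. \<rho> (Suc n) \<in> succs I U w (\<rho> n))}"

definition subtree :: "'a set \<Rightarrow> ('a \<Rightarrow> 'a \<Rightarrow> real) \<Rightarrow> (nat \<Rightarrow> real) \<Rightarrow> 'a vertex \<Rightarrow> 'a vertex set" where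
  "subtree I U w x = {y. (x, y) \<in> {(a, b). b \<in> succs I U w a}\<^sup>*}"

text \<open>Convergence to the ray \<open>\<rho>\<close> as \<open>t\<close> increases to the lifetime: eventually the path stays in
  the subtree hanging from each vertex of \<open>\<rho>\<close>.\<close>

definition converges_to_ray :: "'a set \<Rightarrow> ('a \<Rightarrow> 'a \<Rightarrow> real) \<Rightarrow> (nat \<Rightarrow> real) \<Rightarrow> 'a vertex
    \<Rightarrow> (('a vertex state \<Rightarrow> 'a vertex state) \<times> real) stream \<Rightarrow> (nat \<Rightarrow> 'a vertex) \<Rightarrow> bool" where
  "converges_to_ray I U w x \<omega> \<rho> \<longleftrightarrow>
     (\<forall>n. \<forall>\<^sub>F t in at_left (lifetime (chain_q I U w) (Site x) \<omega>).
        chain_at (chain_q I U w) (Site x) \<omega> t \<in> Some ` Site ` subtree I U w (\<rho> n))"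

definition transient_ext :: "'a set \<Rightarrow> ('a \<Rightarrow> 'a \<Rightarrow> real) \<Rightarrow> (nat \<Rightarrow> real) \<Rightarrow> bool" where
  "transient_ext I U w \<longleftrightarrow>
     \<P>(\<omega> in tree_chain_space I U w. \<exists>\<rho>\<in>rays I U w. converges_to_ray I U w (root I U w) \<omega> \<rho>) > 0"

definition Q_mat ::
    "'a set \<Rightarrow> ('a \<Rightarrow> 'a \<Rightarrow> real) \<Rightarrow> (nat \<Rightarrow> real) \<Rightarrow> 'a \<Rightarrow> 'a \<Rightarrow> real" where
  "Q_mat I U w i j =
     Q_ext I U w (vertex_of I U i) (vertex_of I U j) +
     (\<Sum>\<^sub>\<infinity>k\<in>tree_ext I U - vertex_of I U ` I.
        Q_ext I U w (vertex_of I U i) k *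
        \<P>(\<omega> in tree_chain_space I U w. chain_at_tau I U w k \<omega> = Some (Site (vertex_of I U j))))"

end

theory Submission
  imports Defs
begin

text \<open>
  Put \<open>A = I \<union> {\<partial>}\<close>. A bounded function \<open>f\<close> on \<open>A\<close> extends to the tree by
  \<open>x \<mapsto> E\<^sub>x f(X\<^sub>\<tau>)\<close>. First-step analysis gives the mean value property off \<open>A\<close>. At \<open>i \<in> I\<close>,
  the sum \<open>\<Sum>\<^sub>j Q\<^sub>i\<^sub>j h(j)\<close> equals the row of the tree's q-matrix at \<open>i\<close> applied to the extension,
  a sum over finitely many neighbours, so harmonicity on \<open>I\<close> yields harmonicity of the extension
  at \<open>i\<close>. Conversely, a bounded harmonic function \<open>g\<close> which vanishes on \<open>A\<close> satisfies
  \<open>|g(x)| \<le> C \<cdot> P\<^sub>x(A is avoided for n jumps)\<close>, which tends to \<open>0\<close> by (H4).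
\<close>

section \<open>Hitting a set in continuous and in discrete time\<close>

lemma jump_time_mono: "m \<le> n \<Longrightarrow> jump_time q x \<omega> m \<le> jump_time q x \<omega> n"
  unfolding jump_time_def by (intro sum_mono2) auto

lemma jump_time_le_lifetime: "jump_time q x \<omega> n \<le> lifetime q x \<omega>"
  unfolding lifetime_def by (rule SUP_upper) simp

text \<open>The strict inequality discards visits of length zero and all visits after an infinite
  holding time, which \<open>chain_at\<close> never shows.\<close>

definition occupied :: "('s \<Rightarrow> 's \<Rightarrow> real) \<Rightarrow> 's set \<Rightarrow> 's \<Rightarrow> (('s \<Rightarrow> 's) \<times> real) stream \<Rightarrow> nat \<Rightarrow> bool" where
  "occupied q A x \<omega> n \<longleftrightarrow>
     jump_time q x \<omega> n < jump_time q x \<omega> (Suc n) \<and> jump_chain x \<omega> n \<in> A"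

text \<open>Jump times are monotone, so the half-open intervals between consecutive ones are
  disjoint and the \<open>LEAST\<close> in \<open>chain_at\<close> selects the only possible
  index.\<close>

lemma chain_at_eq_Some:
  "chain_at q x \<omega> t = Some y \<longleftrightarrow>
     (\<exists>n. jump_time q x \<omega> n \<le> t \<and> t < jump_time q x \<omega> (Suc n) \<and> jump_chain x \<omega> n = y)"
proof -
  let ?P = "\<lambda>n. jump_time q x \<omega> n \<le> t \<and> t < jump_time q x \<omega> (Suc n)"
  have "m = n" if "?P m" "?P n" for m n
  proof (rule ccontr)
    assume "m \<noteq> n"
    then consider "Suc m \<le> n" | "Suc n \<le> m" by linarith
    then show False
      using that jump_time_mono[of "Suc m" n q x \<omega>] jump_time_mono[of "Suc n" m q x \<omega>]
      by cases (metis leD order_trans)+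
  qed
  then have least: "(LEAST n. ?P n) = n" if "?P n" for n
    using that by (metis (mono_tags, lifting) LeastI)
  show ?thesis
  proof (cases "\<exists>n. ?P n")
    case True
    then obtain n where n: "?P n" by blast
    then have "chain_at q x \<omega> t = Some (jump_chain x \<omega> n)"
      unfolding chain_at_def using least[OF n] by auto
    then show ?thesis using n least by auto
  qed (auto simp: chain_at_def)
qed

text \<open>No positivity of the holding times is assumed: a state left at once is simply not seen.
  This makes the right-hand side measurable without completing the measure.\<close>

lemma chain_at_hit_time:
  "chain_at q x \<omega> (hit_time q A x \<omega>) = Some y \<and> y \<in> A \<longleftrightarrow>
     (\<exists>n. occupied q A x \<omega> n \<and> jump_chain x \<omega> n = y \<and> (\<forall>m<n. \<not> occupied q A x \<omega> m))"
  (is "?lhs \<longleftrightarrow> ?rhs")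
proof
  assume ?lhs
  then obtain n where n: "jump_time q x \<omega> n \<le> hit_time q A x \<omega>"
     "hit_time q A x \<omega> < jump_time q x \<omega> (Suc n)" "jump_chain x \<omega> n = y" "y \<in> A"
    by (auto simp: chain_at_eq_Some)
  have "\<not> occupied q A x \<omega> m" if "m < n" for m
  proof
    assume m: "occupied q A x \<omega> m"
    \<comment> \<open>A time inside an earlier visit of positive length would lie before the hitting
      time and yet count as a hit.\<close>
    then obtain t where t: "jump_time q x \<omega> m < t" "t < jump_time q x \<omega> (Suc m)"
      using dense unfolding occupied_def by blast
    with m have "chain_at q x \<omega> t \<in> Some ` A"
      using chain_at_eq_Some[of q x \<omega> t "jump_chain x \<omega> m"]
      by (metis image_eqI less_imp_le occupied_def)
    moreover have "0 < t" using t(1) by (metis not_gr_zero not_less_zero)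
    ultimately have "hit_time q A x \<omega> \<le> t"
      unfolding hit_time_def by (intro min.coboundedI1 Inf_lower) auto
    also have "t < jump_time q x \<omega> (Suc m)" by fact
    also have "\<dots> \<le> jump_time q x \<omega> n" using that by (intro jump_time_mono) simp
    also have "\<dots> \<le> hit_time q A x \<omega>" by fact
    finally show False by simp
  qed
  then show ?rhs using n by (auto simp: occupied_def intro!: exI[of _ n])
next
  assume ?rhs
  then obtain n where n: "occupied q A x \<omega> n" "jump_chain x \<omega> n = y" "\<And>m. m < n \<Longrightarrow> \<not> occupied q A x \<omega> m"
    by auto
  let ?D = "{t. 0 < t \<and> chain_at q x \<omega> t \<in> Some ` A}" and ?T = "jump_time q x \<omega>"
  have "Inf ?D \<le> ?T n"
  \<comment> \<open>The set \<open>?D\<close> admits only positive times, and the visit may begin at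
    time 0. So interior times are used, and they come arbitrarily close to the left end.\<close>
  proof (rule dense_ge_bounded)
    show "?T n < ?T (Suc n)" using n by (simp add: occupied_def)
    fix t assume t: "?T n < t" "t < ?T (Suc n)"
    with n have "chain_at q x \<omega> t \<in> Some ` A"
      using chain_at_eq_Some[of q x \<omega> t "jump_chain x \<omega> n"]
      by (metis image_eqI less_imp_le occupied_def)
    moreover have "0 < t" using t(1) by (metis not_gr_zero not_less_zero)
    ultimately show "Inf ?D \<le> t" by (intro Inf_lower) auto
  qed
  moreover have "?T n \<le> Inf ?D"
  proof (rule Inf_greatest)
    fix t assume "t \<in> ?D"
    then obtain m where m: "?T m \<le> t" "t < ?T (Suc m)" "jump_chain x \<omega> m \<in> A"
      by (auto simp: chain_at_eq_Some)
    then have "occupied q A x \<omega> m" by (auto simp: occupied_def)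
    then have "n \<le> m" using n(3) not_less by blast
    then show "?T n \<le> t" using jump_time_mono[of n m q x \<omega>] m(1) by simp
  qed
  ultimately have "hit_time q A x \<omega> = ?T n"
    using jump_time_le_lifetime[of q x \<omega> n] unfolding hit_time_def by simp
  then show ?lhs
    using n by (auto simp: chain_at_eq_Some occupied_def)
qed

section \<open>First entry and avoidance for the jump chain\<close>

definition first_entry :: "'s set \<Rightarrow> 's \<Rightarrow> 's \<Rightarrow> (('s \<Rightarrow> 's) \<times> real) stream \<Rightarrow> bool" where
  "first_entry A y x \<omega> \<longleftrightarrow>
     (\<exists>n. jump_chain x \<omega> n = y \<and> y \<in> A \<and> (\<forall>m<n. jump_chain x \<omega> m \<notin> A))"

definition avoids :: "'s set \<Rightarrow> nat \<Rightarrow> 's \<Rightarrow> (('s \<Rightarrow> 's) \<times> real) stream \<Rightarrow> bool" where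
  "avoids A n x \<omega> \<longleftrightarrow> (\<forall>m\<le>n. jump_chain x \<omega> m \<notin> A)"

text \<open>The pathwise form of the Markov property: deleting the first pair restarts the chain at
  its state after one jump.\<close>

lemma jump_chain_Stream: "jump_chain x (s ## \<omega>) (Suc n) = jump_chain (fst s x) \<omega> n"
  by (induction n) auto

lemma first_entry_unique: "first_entry A y x \<omega> \<Longrightarrow> first_entry A z x \<omega> \<Longrightarrow> y = z"
  unfolding first_entry_def by (metis linorder_neqE_nat)

lemma first_entry_start: "x \<in> A \<Longrightarrow> first_entry A y x \<omega> \<longleftrightarrow> y = x"
  unfolding first_entry_def by (metis jump_chain.simps(1) neq0_conv not_less0)

text \<open>The start lies outside \<open>A\<close>, so the entry index is positive; deleting the
  first jump lowers it by one and leaves the entry point unchanged.\<close>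

lemma first_entry_Stream:
  assumes "x \<notin> A"
  shows "first_entry A y x (s ## \<omega>) \<longleftrightarrow> first_entry A y (fst s x) \<omega>"
proof
  assume "first_entry A y x (s ## \<omega>)"
  then obtain n where n: "jump_chain x (s ## \<omega>) n = y" "y \<in> A" "\<forall>m<n. jump_chain x (s ## \<omega>) m \<notin> A"
    by (auto simp: first_entry_def)
  with assms obtain k where k: "n = Suc k" by (cases n) auto
  have "jump_chain (fst s x) \<omega> m \<notin> A" if "m < k" for m
    using n(3) k that jump_chain_Stream[of x s \<omega> m] by (metis Suc_mono)
  then show "first_entry A y (fst s x) \<omega>"
    using n k jump_chain_Stream[of x s \<omega> k] by (auto simp: first_entry_def)
next
  assume "first_entry A y (fst s x) \<omega>"
  then obtain k where k: "jump_chain (fst s x) \<omega> k = y" "y \<in> A" "\<forall>m<k. jump_chain (fst s x) \<omega> m \<notin> A"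
    by (auto simp: first_entry_def)
  have "jump_chain x (s ## \<omega>) m \<notin> A" if "m < Suc k" for m
    using that k assms jump_chain_Stream[of x s \<omega>] by (cases m) auto
  then show "first_entry A y x (s ## \<omega>)"
    using k jump_chain_Stream[of x s \<omega> k]
    by (auto simp: first_entry_def simp del: jump_chain.simps intro!: exI[of _ "Suc k"])
qed

lemma avoids_Stream: "avoids A (Suc n) x (s ## \<omega>) \<longleftrightarrow> x \<notin> A \<and> avoids A n (fst s x) \<omega>"
proof -
  have "(\<forall>m\<le>Suc n. jump_chain x (s ## \<omega>) m \<notin> A) \<longleftrightarrow>
      x \<notin> A \<and> (\<forall>m\<le>n. jump_chain x (s ## \<omega>) (Suc m) \<notin> A)"
    by (metis Suc_le_mono jump_chain.simps(1) le0 not0_implies_Suc)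
  then show ?thesis by (simp add: avoids_def jump_chain_Stream del: jump_chain.simps)
qed

text \<open>Here the holding times are positive up to the first entry, so that the continuous-time and
  the discrete-time hitting points agree.\<close>

lemma chain_at_hit_time_eq_first_entry:
  assumes pos: "\<And>n. 0 < snd (\<omega> !! n)"
    and rate: "\<And>n. jump_chain x \<omega> n \<notin> A \<Longrightarrow> q (jump_chain x \<omega> n) (jump_chain x \<omega> n) < 0"
  shows "chain_at q x \<omega> (hit_time q A x \<omega>) = Some y \<and> y \<in> A \<longleftrightarrow> first_entry A y x \<omega>"
proof -
  have hold_pos: "0 < holding_time q x \<omega> n" for n
    unfolding holding_time_def using pos[of n]
    by (simp add: ennreal_zero_less_divide)
  have hold_fin: "holding_time q x \<omega> n < \<top>" if "jump_chain x \<omega> n \<notin> A" for n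
    unfolding holding_time_def using rate[OF that] pos[of n]
    by (simp add: divide_ennreal)
  have occ: "occupied q A x \<omega> n" if "jump_chain x \<omega> n \<in> A" "\<forall>m<n. jump_chain x \<omega> m \<notin> A" for n
  proof -
    \<comment> \<open>All states before index \<open>n\<close> lie outside \<open>A\<close> and have
      finite holding times. Finiteness makes the addition of the next holding time, possibly
      infinite if the state in \<open>A\<close> is absorbing, a strict increase.\<close>
    have "jump_time q x \<omega> n < \<top>"
      unfolding jump_time_def using that hold_fin by (simp add: ennreal_sum_less_top)
    then have "jump_time q x \<omega> n + 0 < jump_time q x \<omega> n + holding_time q x \<omega> n"
      using hold_pos[of n] by (subst ennreal_add_left_cancel_less) auto
    then have "jump_time q x \<omega> n < jump_time q x \<omega> (Suc n)"
      by (simp add: jump_time_def)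
    then show ?thesis using that by (simp add: occupied_def)
  qed
  show ?thesis
    unfolding chain_at_hit_time
  proof
    assume "first_entry A y x \<omega>"
    then obtain n where n: "jump_chain x \<omega> n = y" "y \<in> A" "\<forall>m<n. jump_chain x \<omega> m \<notin> A"
      by (auto simp: first_entry_def)
    then show "\<exists>n. occupied q A x \<omega> n \<and> jump_chain x \<omega> n = y \<and> (\<forall>m<n. \<not> occupied q A x \<omega> m)"
      using occ[of n] by (auto simp: occupied_def intro!: exI[of _ n])
  next
    assume "\<exists>n. occupied q A x \<omega> n \<and> jump_chain x \<omega> n = y \<and> (\<forall>m<n. \<not> occupied q A x \<omega> m)"
    then obtain n where n: "occupied q A x \<omega> n" "jump_chain x \<omega> n = y" "\<forall>m<n. \<not> occupied q A x \<omega> m"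
      by blast
    \<comment> \<open>If \<open>m\<close> were the first index before \<open>n\<close> with state in
      \<open>A\<close>, then \<open>occ\<close> would make \<open>m\<close> occupied.\<close>
    have "jump_chain x \<omega> m \<notin> A" if "m < n" for m
      using that
    proof (induction m rule: less_induct)
      case (less m)
      then show ?case using occ[of m] n(3) by auto
    qed
    then show "first_entry A y x \<omega>"
      using n by (auto simp: first_entry_def occupied_def)
  qed
qed

section \<open>First-step analysis\<close>

text \<open>Finite rows turn one-step expectations into finite sums, which commute with the infinite
  sums over exit points.\<close>

locale finite_range_chain =
  fixes S :: "'s set" and q :: "'s \<Rightarrow> 's \<Rightarrow> real"
  assumes countable_S: "countable S"
    and finite_row: "x \<in> S \<Longrightarrow> finite {y \<in> S. q x y \<noteq> 0}"
    and nonneg: "x \<in> S \<Longrightarrow> y \<in> S \<Longrightarrow> x \<noteq> y \<Longrightarrow> 0 \<le> q x y"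
    and conservative: "x \<in> S \<Longrightarrow> (q x has_sum 0) S"
begin

definition targets :: "'s \<Rightarrow> 's set" where
  "targets x = {y \<in> S. jump_prob q x y \<noteq> 0}"

lemma targets_subset: "targets x \<subseteq> S"
  by (auto simp: targets_def)

lemma finite_targets:
  assumes "x \<in> S" shows "finite (targets x)"
  by (rule finite_subset[of _ "insert x {y \<in> S. q x y \<noteq> 0}"])
     (use finite_row[OF assms] in \<open>auto simp: targets_def jump_prob_def split: if_splits\<close>)

lemma sum_row:
  assumes "x \<in> S" shows "(\<Sum>y | y \<in> S \<and> q x y \<noteq> 0. q x y) = 0"
proof -
  have "(q x has_sum (\<Sum>y | y \<in> S \<and> q x y \<noteq> 0. q x y)) S"
    using finite_row[OF assms] by (intro has_sum_finite_neutralI) auto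
  then show ?thesis using conservative[OF assms] has_sum_unique by blast
qed

text \<open>A positive diagonal entry beside nonnegative off-diagonal ones would give the row a
  positive sum.\<close>

lemma rate_nonpos:
  assumes "x \<in> S" shows "q x x \<le> 0"
proof (rule ccontr)
  assume "\<not> q x x \<le> 0"
  then have "0 < (\<Sum>y | y \<in> S \<and> q x y \<noteq> 0. q x y)"
    using finite_row[OF assms] nonneg[OF assms] assms
    by (intro sum_pos2[of _ x]) (auto, fastforce)
  then show False using sum_row[OF assms] by simp
qed

lemma jump_prob_nonneg: "x \<in> S \<Longrightarrow> y \<in> S \<Longrightarrow> 0 \<le> jump_prob q x y"
  using nonneg rate_nonpos by (auto simp: jump_prob_def intro: divide_nonneg_nonpos)

text \<open>The generator factors as the exit rate times the jump kernel minus the identity.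
  Division by the rate then turns harmonicity into the mean value property.\<close>

lemma has_sum_jump_prob_mult:
  assumes "x \<in> S" and "q x x \<noteq> 0"
  shows "((\<lambda>y. q x y * g y) has_sum (- q x x) * ((\<Sum>y\<in>targets x. jump_prob q x y * g y) - g x)) S"
proof (rule has_sum_finite_neutralI)
  show "finite {y \<in> S. q x y \<noteq> 0}" by (rule finite_row) fact
  have eq: "{y \<in> S. q x y \<noteq> 0} = insert x (targets x)" and "x \<notin> targets x"
    using assms by (auto simp: targets_def jump_prob_def)
  then have "(\<Sum>y | y \<in> S \<and> q x y \<noteq> 0. q x y * g y) = q x x * g x + (\<Sum>y\<in>targets x. q x y * g y)"
    using finite_targets[OF assms(1)] by simp
  also have "(\<Sum>y\<in>targets x. q x y * g y) = (\<Sum>y\<in>targets x. (- q x x) * (jump_prob q x y * g y))"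
    using assms by (intro sum.cong) (auto simp: targets_def jump_prob_def)
  finally show "(- q x x) * ((\<Sum>y\<in>targets x. jump_prob q x y * g y) - g x) =
      (\<Sum>y | y \<in> S \<and> q x y \<noteq> 0. q x y * g y)"
    by (simp add: sum_distrib_left algebra_simps)
qed auto

lemma harmonic_iff_mean_value:
  assumes "x \<in> S" and "q x x \<noteq> 0"
  shows "((\<lambda>y. q x y * g y) has_sum 0) S \<longleftrightarrow> g x = (\<Sum>y\<in>targets x. jump_prob q x y * g y)"
proof
  assume "((\<lambda>y. q x y * g y) has_sum 0) S"
  from has_sum_unique[OF this has_sum_jump_prob_mult[OF assms]] assms
  show "g x = (\<Sum>y\<in>targets x. jump_prob q x y * g y)" by simp
qed (use has_sum_jump_prob_mult[OF assms, of g] in simp)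

text \<open>For nonzero rate this is the mean value property of the constant 1, which
  conservativeness provides; a state of rate 0 is its own only target.\<close>

lemma sum_jump_prob:
  assumes "x \<in> S" shows "(\<Sum>y\<in>targets x. jump_prob q x y) = 1"
proof (cases "q x x = 0")
  case True
  then have "targets x = {x}" using assms by (auto simp: targets_def jump_prob_def)
  then show ?thesis using True by (simp add: jump_prob_def)
next
  case False
  then show ?thesis
    using harmonic_iff_mean_value[OF assms False, of "\<lambda>_. 1"] conservative[OF assms] by simp
qed

section \<open>The law of one step and the Markov property at the first jump\<close>

abbreviation "jump_law x \<equiv> point_measure S (\<lambda>y. ennreal (jump_prob q x y))"
abbreviation "step_law \<equiv> (PiM S jump_law) \<Otimes>\<^sub>M density lborel (\<lambda>t. ennreal (exponential_density 1 t))"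

lemma nn_integral_jump_law:
  assumes "x \<in> S"
  shows "(\<integral>\<^sup>+y. f y \<partial>jump_law x) = (\<Sum>y\<in>targets x. ennreal (jump_prob q x y) * f y)"
proof -
  \<comment> \<open>The integral of a point measure is a sum over a support that depends on
    \<open>f\<close>; enclosing it in \<open>targets x\<close> gives finiteness and an index set
    independent of \<open>f\<close>.\<close>
  have sub: "{a \<in> S. 0 < ennreal (jump_prob q x a) \<and> 0 < f a} \<subseteq> targets x"
    by (auto simp: targets_def)
  then have "finite {a \<in> S. 0 < ennreal (jump_prob q x a) \<and> 0 < f a}"
    using finite_targets[OF assms] finite_subset by blast
  then have "(\<integral>\<^sup>+y. f y \<partial>jump_law x) =
     (\<Sum>y | y \<in> S \<and> 0 < ennreal (jump_prob q x y) \<and> 0 < f y. ennreal (jump_prob q x y) * f y)"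
    by (rule nn_integral_point_measure)
  also have "\<dots> = (\<Sum>y\<in>targets x. ennreal (jump_prob q x y) * f y)"
    using sub finite_targets[OF assms] jump_prob_nonneg[OF assms]
    by (intro sum.mono_neutral_left) (auto simp: targets_def less_le)
  finally show ?thesis .
qed

lemma prob_space_jump_law: assumes "x \<in> S" shows "prob_space (jump_law x)"
proof (rule prob_spaceI)
  have "emeasure (jump_law x) (space (jump_law x)) = (\<Sum>y\<in>targets x. ennreal (jump_prob q x y))"
    using nn_integral_jump_law[OF assms, of "\<lambda>_. 1"] by simp
  also have "\<dots> = ennreal (\<Sum>y\<in>targets x. jump_prob q x y)"
    using jump_prob_nonneg[OF assms] targets_subset by (intro sum_ennreal) auto
  finally show "emeasure (jump_law x) (space (jump_law x)) = 1"
    by (simp add: sum_jump_prob[OF assms])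
qed

sublocale holding: prob_space "density lborel (\<lambda>t. ennreal (exponential_density 1 t))"
  by (rule prob_space_exponential_density) simp

sublocale jumps: prob_space "PiM S jump_law"
  by (rule prob_space_PiM) (rule prob_space_jump_law)

sublocale step: pair_prob_space "PiM S jump_law" "density lborel (\<lambda>t. ennreal (exponential_density 1 t))" ..

lemma chain_space_eq: "chain_space S q = stream_space step_law"
  by (simp add: chain_space_def)

sublocale chain: prob_space "chain_space S q"
  unfolding chain_space_eq by (rule step.prob_space_stream_space)

lemma space_jump_law [simp]: "space (jump_law x) = S"
  by (simp add: space_point_measure)

lemma measurable_jump_law_eq: "measurable M (jump_law x) = measurable M (count_space S)"
  by (intro measurable_cong_sets) (simp_all add: sets_point_measure)

text \<open>Only coordinate \<open>x\<close> of the random map is read: the holding time integrates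
  out to 1, and that coordinate of the product has law \<open>jump_law x\<close>.\<close>

lemma nn_integral_step:
  assumes "x \<in> S"
  shows "(\<integral>\<^sup>+s. f (fst s x) \<partial>step_law) = (\<Sum>y\<in>targets x. ennreal (jump_prob q x y) * f y)"
proof -
  have comp: "(\<lambda>F. F x) \<in> measurable (PiM S jump_law) (jump_law x)"
    using assms by (rule measurable_component_singleton)
  have f: "f \<in> borel_measurable (jump_law x)"
    by (simp add: measurable_def sets_point_measure)
  have "(\<integral>\<^sup>+s. f (fst s x) \<partial>step_law) = (\<integral>\<^sup>+F. f (F x) \<partial>PiM S jump_law)"
    by (subst holding.nn_integral_fst[symmetric])
       (auto simp: holding.emeasure_space_1[simplified]
         intro!: measurable_compose[OF measurable_fst] measurable_compose[OF comp f])
  also have "\<dots> = (\<integral>\<^sup>+y. f y \<partial>distr (PiM S jump_law) (jump_law x) (\<lambda>F. F x))"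
    by (rule nn_integral_distr[OF comp, symmetric]) (simp add: f)
  also have "distr (PiM S jump_law) (jump_law x) (\<lambda>F. F x) = jump_law x"
    using prob_space_jump_law assms by (rule distr_PiM_component)
  finally show ?thesis by (simp add: nn_integral_jump_law[OF assms])
qed

text \<open>A stream is a first pair followed by an independent stream of the same law. Hypothesis
  \<open>shift\<close> says that the first pair matters only through the new state, so conditioning
  on it yields a finite average.\<close>

lemma prob_first_step:
  assumes x: "x \<in> S" and P: "Measurable.pred (chain_space S q) P"
    and P': "\<And>y. y \<in> S \<Longrightarrow> Measurable.pred (chain_space S q) (P' y)"
    and shift: "\<And>s \<omega>. P (s ## \<omega>) \<longleftrightarrow> P' (fst s x) \<omega>"
  shows "\<P>(\<omega> in chain_space S q. P \<omega>) =
     (\<Sum>y\<in>targets x. jump_prob q x y * \<P>(\<omega> in chain_space S q. P' y \<omega>))"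
proof -
  have "ennreal \<P>(\<omega> in chain_space S q. P \<omega>) =
     (\<integral>\<^sup>+s. \<P>(\<omega> in chain_space S q. P' (fst s x) \<omega>) \<partial>step_law)"
    using step.prob_stream_space[of P] P unfolding chain_space_eq shift by (simp add: pred_def)
  also have "\<dots> = (\<Sum>y\<in>targets x. ennreal (jump_prob q x y) * \<P>(\<omega> in chain_space S q. P' y \<omega>))"
    using nn_integral_step[OF x, of "\<lambda>y. ennreal \<P>(\<omega> in chain_space S q. P' y \<omega>)"] by simp
  also have "\<dots> = (\<Sum>y\<in>targets x. ennreal (jump_prob q x y * \<P>(\<omega> in chain_space S q. P' y \<omega>)))"
    using targets_subset[of x] jump_prob_nonneg[OF x] by (intro sum.cong refl ennreal_mult[symmetric]) auto
  also have "\<dots> = ennreal (\<Sum>y\<in>targets x. jump_prob q x y * \<P>(\<omega> in chain_space S q. P' y \<omega>))"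
    using targets_subset[of x] jump_prob_nonneg[OF x] by (intro sum_ennreal) auto
  finally show ?thesis
    using targets_subset[of x] jump_prob_nonneg[OF x]
    by (subst (asm) ennreal_inj) (auto intro!: sum_nonneg)
qed

section \<open>Measurability of the chain and positivity of holding times\<close>

lemma measurable_jump_chain:
  assumes "x \<in> S"
  shows "(\<lambda>\<omega>. jump_chain x \<omega> n) \<in> measurable (chain_space S q) (count_space S)"
proof (induction n)
  case (Suc n)
  have "(\<lambda>\<omega>. fst (\<omega> !! n) (jump_chain x \<omega> n)) \<in> measurable (chain_space S q) (count_space S)"
  \<comment> \<open>The random map is evaluated at a random state; countability of \<open>S\<close>
    reduces this to evaluation at a fixed state.\<close>
  proof (rule measurable_compose_countable'[OF _ Suc countable_S])
    fix y assume y: "y \<in> S"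
    have "(\<lambda>s. fst s y) \<in> measurable step_law (jump_law y)"
      by (rule measurable_compose[OF measurable_fst measurable_component_singleton[OF y]])
    then have "(\<lambda>\<omega>. fst (\<omega> !! n) y) \<in> measurable (stream_space step_law) (jump_law y)"
      by (rule measurable_compose[OF measurable_snth])
    then show "(\<lambda>\<omega>. fst (\<omega> !! n) y) \<in> measurable (chain_space S q) (count_space S)"
      by (simp add: chain_space_eq measurable_jump_law_eq)
  qed
  then show ?case by simp
qed (use assms in simp)

lemma jump_chain_in_S: "x \<in> S \<Longrightarrow> \<omega> \<in> space (chain_space S q) \<Longrightarrow> jump_chain x \<omega> n \<in> S"
  using measurable_space[OF measurable_jump_chain[of x n]] by simp

lemma pred_jump_chain:
  assumes "x \<in> S" shows "Measurable.pred (chain_space S q) (\<lambda>\<omega>. R (jump_chain x \<omega> n))"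
  by (rule measurable_compose[OF measurable_jump_chain[OF assms]]) simp

lemma measurable_jump_time:
  assumes "x \<in> S" shows "(\<lambda>\<omega>. jump_time q x \<omega> n) \<in> borel_measurable (chain_space S q)"
proof -
  have [measurable]: "(\<lambda>\<omega>. ennreal (- q (jump_chain x \<omega> k) (jump_chain x \<omega> k)))
      \<in> borel_measurable (chain_space S q)" for k
    by (rule measurable_compose[OF measurable_jump_chain[OF assms]]) simp
  have "(\<lambda>s. snd s) \<in> borel_measurable step_law"
    by (rule measurable_snd'') simp
  then have [measurable]: "(\<lambda>\<omega>. snd (\<omega> !! k)) \<in> borel_measurable (chain_space S q)" for k
    unfolding chain_space_eq by (rule measurable_compose[OF measurable_snth])
  show ?thesis
    unfolding jump_time_def holding_time_def by measurable
qed

lemma pred_first_entry: 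
  assumes "x \<in> S" shows "Measurable.pred (chain_space S q) (first_entry A y x)"
proof -
  note [measurable] = pred_jump_chain[OF assms]
  show ?thesis
    unfolding first_entry_def by measurable
qed

lemma pred_avoids:
  assumes "x \<in> S" shows "Measurable.pred (chain_space S q) (avoids A n x)"
proof -
  note [measurable] = pred_jump_chain[OF assms]
  show ?thesis
    unfolding avoids_def by measurable
qed

text \<open>The infimum over uncountably many times is replaced by the description through
  \<open>occupied\<close>, which quantifies over natural numbers only.\<close>

lemma pred_chain_at_hit_time:
  assumes "x \<in> S"
  shows "Measurable.pred (chain_space S q) (\<lambda>\<omega>. chain_at q x \<omega> (hit_time q A x \<omega>) = Some y \<and> y \<in> A)"
proof -
  note [measurable] = pred_jump_chain[OF assms] measurable_jump_time[OF assms]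
  show ?thesis
    unfolding chain_at_hit_time occupied_def by measurable
qed

lemma AE_holding_pos: "AE \<omega> in chain_space S q. \<forall>n. 0 < snd (\<omega> !! n)"
proof -
  have "AE t in density lborel (\<lambda>t. ennreal (exponential_density 1 t)). 0 < t"
  proof (subst AE_density)
    show "AE t in lborel. 0 < ennreal (exponential_density 1 t) \<longrightarrow> 0 < (t::real)"
      \<comment> \<open>The exponential density is positive at 0 too, so this point has to be
        removed as a null set.\<close>
      using AE_lborel_singleton[of "0::real"]
      by eventually_elim (auto simp: exponential_density_def)
  qed simp
  moreover have meas: "(\<lambda>s. snd s) \<in> borel_measurable step_law"
    by (rule measurable_snd'') simp
  ultimately have "AE s in step_law. 0 < snd s"
    using borel_measurable_less[OF _ meas, of "\<lambda>_. 0"]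
    by (intro step.AE_pair_measure) simp_all
  then have "AE \<omega> in stream_space step_law. stream_all (\<lambda>s. 0 < snd s) \<omega>"
    using meas by (intro step.AE_stream_all) simp_all
  then show ?thesis
    unfolding chain_space_eq by (simp add: sset_range)
qed

end

section \<open>The bounded Dirichlet problem\<close>

lemma has_sum_sum:
  fixes f :: "'i \<Rightarrow> 'b \<Rightarrow> 'c::topological_comm_monoid_add"
  assumes "finite F" and "\<And>i. i \<in> F \<Longrightarrow> (f i has_sum s i) B"
  shows "((\<lambda>y. \<Sum>i\<in>F. f i y) has_sum (\<Sum>i\<in>F. s i)) B"
  using assms by (induction F rule: finite_induct) (auto intro!: has_sum_add)

context finite_range_chain
begin

text \<open>Defined by the jump chain, so that first-step analysis applies at once;
  \<open>prob_chain_at_hit_time\<close> links it to continuous time.\<close>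

definition exit_prob :: "'s set \<Rightarrow> 's \<Rightarrow> 's \<Rightarrow> real" where
  "exit_prob A x y = \<P>(\<omega> in chain_space S q. first_entry A y x \<omega>)"

text \<open>The Poisson-type solution of the Dirichlet problem with data \<open>f\<close> on
  \<open>A\<close>; paths that never enter \<open>A\<close> contribute 0.\<close>

definition exit_mean :: "'s set \<Rightarrow> ('s \<Rightarrow> real) \<Rightarrow> 's \<Rightarrow> real" where
  "exit_mean A f x = (\<Sum>\<^sub>\<infinity>y\<in>A. exit_prob A x y * f y)"

lemma exit_prob_nonneg: "0 \<le> exit_prob A x y"
  by (simp add: exit_prob_def)

lemma exit_prob_start: "x \<in> A \<Longrightarrow> exit_prob A x y = of_bool (y = x)"
  by (simp add: exit_prob_def first_entry_start chain.prob_space)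

lemma exit_prob_step:
  assumes "x \<in> S" "x \<notin> A"
  shows "exit_prob A x y = (\<Sum>z\<in>targets x. jump_prob q x z * exit_prob A z y)"
  unfolding exit_prob_def
  using assms by (intro prob_first_step pred_first_entry first_entry_Stream)

text \<open>A path has at most one entry point, so the events are disjoint; the defect is the
  probability of never entering \<open>A\<close>.\<close>

lemma sum_exit_prob_le_1:
  assumes "x \<in> S" and "finite F"
  shows "(\<Sum>y\<in>F. exit_prob A x y) \<le> 1"
proof -
  have "(\<Sum>y\<in>F. exit_prob A x y) = chain.prob (\<Union>y\<in>F. {\<omega> \<in> space (chain_space S q). first_entry A y x \<omega>})"
    unfolding exit_prob_def using pred_first_entry[OF assms(1)]
    by (intro chain.finite_measure_finite_Union[symmetric] assms)
       (auto simp: pred_def disjoint_family_on_def dest: first_entry_unique)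
  then show ?thesis by simp
qed

lemma exit_prob_summable:
  assumes "x \<in> S" shows "exit_prob A x summable_on B"
  by (rule nonneg_bdd_above_summable_on)
     (auto simp: exit_prob_nonneg intro!: bdd_aboveI2[where M = 1] sum_exit_prob_le_1 assms)

lemma exit_mean_has_sum:
  assumes "x \<in> S" and "\<And>y. y \<in> A \<Longrightarrow> \<bar>f y\<bar> \<le> C"
  shows "((\<lambda>y. exit_prob A x y * f y) has_sum exit_mean A f x) A"
proof -
  have "(\<lambda>y. exit_prob A x y * C) summable_on A"
    by (intro summable_on_cmult_left exit_prob_summable assms)
  then have "(\<lambda>y. norm (exit_prob A x y * f y)) summable_on A"
    by (rule Infinite_Sum.abs_summable_on_comparison_test')
       (auto simp: abs_mult exit_prob_nonneg intro!: mult_left_mono assms)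
  then show ?thesis
    unfolding exit_mean_def by (intro has_sum_infsum) (rule abs_summable_summable)
qed

lemma exit_mean_start: "x \<in> A \<Longrightarrow> exit_mean A f x = f x"
  unfolding exit_mean_def
  by (intro infsumI has_sum_finite_neutralI[of "{x}"]) (auto simp: exit_prob_start)

text \<open>The weights have total mass at most 1, so every finite partial sum lies between
  \<open>- C\<close> and \<open>C\<close>, and both bounds pass to the limit.\<close>

lemma exit_mean_bound:
  assumes "x \<in> S" and "\<And>y. y \<in> A \<Longrightarrow> \<bar>f y\<bar> \<le> C" and "0 \<le> C"
  shows "\<bar>exit_mean A f x\<bar> \<le> C"
proof -
  have le: "(\<Sum>y\<in>F. exit_prob A x y * f y) \<le> C" "- C \<le> (\<Sum>y\<in>F. exit_prob A x y * f y)"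
    if "finite F" "F \<subseteq> A" for F
  proof -
    have "\<bar>\<Sum>y\<in>F. exit_prob A x y * f y\<bar> \<le> (\<Sum>y\<in>F. exit_prob A x y * C)"
      using that assms(2)
      by (intro order_trans[OF sum_abs] sum_mono)
         (auto simp: abs_mult exit_prob_nonneg intro!: mult_left_mono)
    also have "\<dots> = (\<Sum>y\<in>F. exit_prob A x y) * C"
      by (simp add: sum_distrib_right)
    also have "\<dots> \<le> 1 * C"
      using assms that by (intro mult_right_mono sum_exit_prob_le_1)
    finally show "(\<Sum>y\<in>F. exit_prob A x y * f y) \<le> C" "- C \<le> (\<Sum>y\<in>F. exit_prob A x y * f y)"
      by linarith+
  qed
  have hs: "((\<lambda>y. exit_prob A x y * f y) has_sum exit_mean A f x) A"
    using assms(1,2) by (rule exit_mean_has_sum)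
  have "exit_mean A f x \<le> C"
    using hs le(1) by (rule has_sum_le_finite_sums)
  moreover have "- exit_mean A f x \<le> C"
    using le(2) by (intro has_sum_le_finite_sums[OF has_sum_uminusI[OF hs]])
      (auto simp: sum_negf minus_le_iff intro: le)
  ultimately show ?thesis by linarith
qed

text \<open>Both sides are sums of one series over \<open>A\<close>: each exit probability is
  expanded by its first step, and the finite sum over targets is exchanged with the series.\<close>

lemma exit_mean_mean_value:
  assumes x: "x \<in> S" "x \<notin> A" and f: "\<And>y. y \<in> A \<Longrightarrow> \<bar>f y\<bar> \<le> C"
  shows "exit_mean A f x = (\<Sum>z\<in>targets x. jump_prob q x z * exit_mean A f z)"
proof -
  have "((\<lambda>y. \<Sum>z\<in>targets x. jump_prob q x z * (exit_prob A z y * f y)) has_sum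
      (\<Sum>z\<in>targets x. jump_prob q x z * exit_mean A f z)) A"
  proof (intro has_sum_sum has_sum_cmult_right finite_targets x)
    fix z assume "z \<in> targets x"
    then have "z \<in> S" using targets_subset by blast
    then show "((\<lambda>y. exit_prob A z y * f y) has_sum exit_mean A f z) A"
      using f by (rule exit_mean_has_sum)
  qed
  also have "(\<lambda>y. \<Sum>z\<in>targets x. jump_prob q x z * (exit_prob A z y * f y)) =
      (\<lambda>y. exit_prob A x y * f y)"
    by (simp add: exit_prob_step[OF x] sum_distrib_right mult.assoc)
  finally have rhs: "((\<lambda>y. exit_prob A x y * f y) has_sum
      (\<Sum>z\<in>targets x. jump_prob q x z * exit_mean A f z)) A" .
  have "((\<lambda>y. exit_prob A x y * f y) has_sum exit_mean A f x) A"
    using x(1) f by (rule exit_mean_has_sum)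
  from has_sum_unique[OF this rhs] show ?thesis .
qed

text \<open>Outside the null set where some holding time is not positive, the hitting point in
  continuous time is the first entry point of the jump chain.\<close>

lemma prob_chain_at_hit_time:
  assumes x: "x \<in> S" and rate: "\<And>z. z \<in> S \<Longrightarrow> z \<notin> A \<Longrightarrow> q z z < 0" and y: "y \<in> A"
  shows "\<P>(\<omega> in chain_space S q. chain_at q x \<omega> (hit_time q A x \<omega>) = Some y) = exit_prob A x y"
proof -
  let ?M = "chain_space S q"
  have "AE \<omega> in ?M. (chain_at q x \<omega> (hit_time q A x \<omega>) = Some y \<and> y \<in> A) = first_entry A y x \<omega>"
    using AE_holding_pos AE_space
  proof eventually_elim
    case (elim \<omega>)
    then show ?case
      using chain_at_hit_time_eq_first_entry[of \<omega> x A q y] rate jump_chain_in_S[OF x] by blast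
  qed
  then have "\<P>(\<omega> in ?M. chain_at q x \<omega> (hit_time q A x \<omega>) = Some y \<and> y \<in> A) =
      \<P>(\<omega> in ?M. first_entry A y x \<omega>)"
    using pred_chain_at_hit_time[OF x] pred_first_entry[OF x]
    by (intro measure_eq_AE) (auto simp: pred_def)
  then show ?thesis using y by (simp add: exit_prob_def)
qed

text \<open>The avoidance events decrease to an event disjoint from the almost sure event of hitting
  \<open>A\<close>, so continuity from above applies.\<close>

lemma prob_avoids_tendsto_0:
  assumes x: "x \<in> S" and hit: "\<P>(\<omega> in chain_space S q. chain_at q x \<omega> (hit_time q A x \<omega>) \<in> Some ` A) = 1"
  shows "(\<lambda>n. \<P>(\<omega> in chain_space S q. avoids A n x \<omega>)) \<longlonglongrightarrow> 0"
proof -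
  let ?M = "chain_space S q"
  let ?H = "{\<omega> \<in> space ?M. chain_at q x \<omega> (hit_time q A x \<omega>) \<in> Some ` A}"
  let ?N = "\<lambda>n. {\<omega> \<in> space ?M. avoids A n x \<omega>}"
  have N: "?N n \<in> sets ?M" for n
    using pred_avoids[OF x, of A n] by (simp add: pred_def)
  \<comment> \<open>A set outside the sigma-algebra has measure 0 by convention, so probability 1
    forces measurability.\<close>
  have H: "?H \<in> sets ?M"
    using hit measure_notin_sets by fastforce
  have "(\<Inter>n. ?N n) \<subseteq> space ?M - ?H"
  proof (intro subsetI DiffI notI)
    fix \<omega> assume 1: "\<omega> \<in> (\<Inter>n. ?N n)" "\<omega> \<in> ?H"
    then obtain y where "chain_at q x \<omega> (hit_time q A x \<omega>) = Some y \<and> y \<in> A" by auto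
    then obtain n where "jump_chain x \<omega> n \<in> A"
      unfolding chain_at_hit_time by (auto simp: occupied_def)
    with 1(1) show False by (auto simp: avoids_def)
  qed auto
  then have "measure ?M (\<Inter>n. ?N n) \<le> measure ?M (space ?M - ?H)"
    using H by (intro chain.finite_measure_mono) auto
  also have "\<dots> = 0" using H hit by (simp add: chain.prob_compl)
  finally have "measure ?M (\<Inter>n. ?N n) = 0"
    using measure_nonneg[of ?M "\<Inter>n. ?N n"] by linarith
  moreover have "decseq ?N"
    by (auto simp: decseq_def avoids_def)
  then have "(\<lambda>n. measure ?M (?N n)) \<longlonglongrightarrow> measure ?M (\<Inter>n. ?N n)"
    using N by (intro chain.finite_Lim_measure_decseq) auto
  ultimately show ?thesis by metis
qed

text \<open>Iterating the mean value property \<open>n\<close> times, only paths still outside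
  \<open>A\<close> contribute, because \<open>g\<close> vanishes on \<open>A\<close>; each
  contributes at most \<open>C\<close>.\<close>

lemma bounded_harmonic_le_avoids:
  assumes mean: "\<And>x. x \<in> S \<Longrightarrow> x \<notin> A \<Longrightarrow> g x = (\<Sum>z\<in>targets x. jump_prob q x z * g z)"
    and bound: "\<And>x. x \<in> S \<Longrightarrow> \<bar>g x\<bar> \<le> C" and zero: "\<And>x. x \<in> S \<Longrightarrow> x \<in> A \<Longrightarrow> g x = 0"
    and "x \<in> S"
  shows "\<bar>g x\<bar> \<le> C * \<P>(\<omega> in chain_space S q. avoids A n x \<omega>)"
  using \<open>x \<in> S\<close>
proof (induction n arbitrary: x)
  case 0
  then show ?case
    using bound[OF 0] zero[OF 0] by (cases "x \<in> A") (auto simp: avoids_def chain.prob_space)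
next
  case (Suc n)
  have C: "0 \<le> C" using bound[OF Suc.prems] by linarith
  show ?case
  proof (cases "x \<in> A")
    case False
    have "\<bar>g x\<bar> \<le> (\<Sum>z\<in>targets x. \<bar>jump_prob q x z * g z\<bar>)"
      unfolding mean[OF Suc.prems False] by (rule sum_abs)
    also have "\<dots> \<le> (\<Sum>z\<in>targets x. jump_prob q x z * (C * \<P>(\<omega> in chain_space S q. avoids A n z \<omega>)))"
      using targets_subset jump_prob_nonneg[OF Suc.prems]
      by (intro sum_mono) (auto simp: abs_mult subset_eq intro!: mult_left_mono Suc.IH)
    also have "\<dots> = C * (\<Sum>z\<in>targets x. jump_prob q x z * \<P>(\<omega> in chain_space S q. avoids A n z \<omega>))"
      by (simp add: sum_distrib_left mult_ac)
    also have "(\<Sum>z\<in>targets x. jump_prob q x z * \<P>(\<omega> in chain_space S q. avoids A n z \<omega>)) =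
        \<P>(\<omega> in chain_space S q. avoids A (Suc n) x \<omega>)"
      using Suc.prems False by (intro prob_first_step[symmetric] pred_avoids) (auto simp: avoids_Stream)
    finally show ?thesis .
  qed (use zero Suc.prems C in simp)
qed

lemma bounded_harmonic_eq_0:
  assumes mean: "\<And>x. x \<in> S \<Longrightarrow> x \<notin> A \<Longrightarrow> g x = (\<Sum>z\<in>targets x. jump_prob q x z * g z)"
    and bound: "\<And>x. x \<in> S \<Longrightarrow> \<bar>g x\<bar> \<le> C" and zero: "\<And>x. x \<in> S \<Longrightarrow> x \<in> A \<Longrightarrow> g x = 0"
    and hit: "\<And>x. x \<in> S \<Longrightarrow> x \<notin> A \<Longrightarrow>
      \<P>(\<omega> in chain_space S q. chain_at q x \<omega> (hit_time q A x \<omega>) \<in> Some ` A) = 1"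
    and "x \<in> S"
  shows "g x = 0"
proof (cases "x \<in> A")
  case False
  have "(\<lambda>n. C * \<P>(\<omega> in chain_space S q. avoids A n x \<omega>)) \<longlonglongrightarrow> C * 0"
    using prob_avoids_tendsto_0[OF \<open>x \<in> S\<close> hit[OF \<open>x \<in> S\<close> False]] by (rule tendsto_mult_left)
  then have "\<bar>g x\<bar> \<le> C * 0"
    using bounded_harmonic_le_avoids[OF mean bound zero \<open>x \<in> S\<close>]
    by (intro LIMSEQ_le_const) auto
  then show ?thesis by simp
qed (use zero \<open>x \<in> S\<close> in simp)

end

section \<open>The tree extension\<close>

text \<open>These conditions yield the tree and its q-matrix. (H1) enters through
  \<open>inj_on_vertex_of\<close> and (H4) through
  \<open>bounded_harmonic_determined\<close>.\<close>

locale ultrametric_tree =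
  fixes I :: "'a set" and U :: "'a \<Rightarrow> 'a \<Rightarrow> real" and w :: "nat \<Rightarrow> real"
  assumes ultrametric: "ultrametric_matrix I U"
    and values_pos: "matrix_values I U \<subseteq> {0<..}"
    and mono: "strict_mono w" and range_w: "range w = matrix_values I U"
    and finite_classes: "v \<in> matrix_values I U \<Longrightarrow> finite (J_set I U v // J_rel I U v)"
begin

abbreviation "T \<equiv> tree_ext I U"
abbreviation "Q \<equiv> Q_ext I U w"
abbreviation "succ \<equiv> succs I U w"
abbreviation "lev \<equiv> level w"

lemma U_sym: "i \<in> I \<Longrightarrow> j \<in> I \<Longrightarrow> U i j = U j i"
  using ultrametric by (auto simp: ultrametric_matrix_def)

lemma U_min: "i \<in> I \<Longrightarrow> j \<in> I \<Longrightarrow> k \<in> I \<Longrightarrow> min (U i k) (U k j) \<le> U i j"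
  using ultrametric by (auto simp: ultrametric_matrix_def)

lemma U_value: "i \<in> I \<Longrightarrow> j \<in> I \<Longrightarrow> \<exists>n. U i j = w n"
  using range_w by (fastforce simp: matrix_values_def)

text \<open>Transitivity is the ultrametric inequality; reflexivity is the reason for restricting to
  \<open>J_set\<close>.\<close>

lemma equiv_J_rel: "equiv (J_set I U v) (J_rel I U v)"
proof (rule equivI)
  show "trans (J_rel I U v)"
    using U_min by (intro transI) (fastforce simp: J_rel_def J_set_def)
qed (auto simp: refl_on_def J_rel_def J_set_def sym_def U_sym)

lemma w_inj: "w m = w n \<longleftrightarrow> m = n"
  using mono by (simp add: strict_mono_eq)

lemma level_eq: "snd x = w n \<Longrightarrow> lev x = n"
  by (simp add: level_def w_inj)

lemma in_T_iff: "(E, w n) \<in> T \<longleftrightarrow> E \<in> J_set I U (w n) // J_rel I U (w n)"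
  using range_w by (auto simp: tree_ext_def)

lemma T_cases:
  assumes "x \<in> T"
  obtains E n where "x = (E, w n)" "E \<in> J_set I U (w n) // J_rel I U (w n)" "lev x = n"
  using assms range_w level_eq that by (fastforce simp: tree_ext_def)

lemma snd_eq_level: "x \<in> T \<Longrightarrow> snd x = w (lev x)"
  by (erule T_cases) simp

lemma finite_level: "finite {x \<in> T. lev x = n}"
proof (rule finite_subset)
  show "{x \<in> T. lev x = n} \<subseteq> (\<lambda>E. (E, w n)) ` (J_set I U (w n) // J_rel I U (w n))"
    by (auto elim!: T_cases)
  show "finite ((\<lambda>E. (E, w n)) ` (J_set I U (w n) // J_rel I U (w n)))"
    using range_w by (intro finite_imageI finite_classes) auto
qed

lemma countable_T: "countable T"
proof (rule countable_subset)
  show "T \<subseteq> (\<Union>n. {x \<in> T. lev x = n})" by auto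
  show "countable (\<Union>n. {x \<in> T. lev x = n})"
    using finite_level by (blast intro: countable_UN countable_finite)
qed

text \<open>The second coordinate of a vertex is \<open>w\<close> of its level, so the level
  condition already makes the two values consecutive and only the overlap of classes
  remains.\<close>

lemma succs_iff:
  assumes "x \<in> T"
  shows "y \<in> succ x \<longleftrightarrow> y \<in> T \<and> lev y = Suc (lev x) \<and> fst x \<inter> fst y \<noteq> {}"
  using snd_eq_level[OF assms] snd_eq_level[of y] by (auto simp: succs_def linked_def)

lemma finite_succs: "finite (succ x)"
  by (rule finite_subset[OF _ finite_level[of "Suc (lev x)"]]) (auto simp: succs_def)

lemma succs_asym: "y \<in> succ x \<Longrightarrow> x \<notin> succ y"
  by (auto simp: succs_def)

lemma succs_irrefl: "x \<notin> succ x"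
  by (auto simp: succs_def)

lemma exists_elem: "\<exists>i. i \<in> I"
  using range_w by (fastforce simp: matrix_values_def)

lemma w_pos: "0 < w n"
  using values_pos range_w by auto

lemma gap_pos: "0 < gap w n"
  using w_pos strict_monoD[OF mono] by (auto simp: gap_def split: nat.split)

text \<open>Since \<open>w 0\<close> is the least value of the matrix, all of \<open>I\<close> forms
  a single class at that height.\<close>

lemma ex1_root: "\<exists>!x. x \<in> T \<and> snd x = w 0"
proof -
  have ge: "w 0 \<le> U i j" if "i \<in> I" "j \<in> I" for i j
    using U_value[OF that] strict_mono_less_eq[OF mono] by fastforce
  then have J: "J_set I U (w 0) = I" "J_rel I U (w 0) = I \<times> I"
    by (auto simp: J_set_def J_rel_def)
  then have "J_set I U (w 0) // J_rel I U (w 0) = {I}"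
    using exists_elem by (auto simp: quotient_def)
  then show ?thesis
    using in_T_iff[of _ 0] by (metis prod.collapse singletonD singletonI snd_conv)
qed

lemma root_in_T: "root I U w \<in> T" and snd_root: "snd (root I U w) = w 0"
  using theI'[OF ex1_root] by (simp_all add: root_def)

lemma root_iff:
  assumes "x \<in> T" shows "x = root I U w \<longleftrightarrow> lev x = 0"
proof
  assume "lev x = 0"
  then have "snd x = w 0" using snd_eq_level[OF assms] by simp
  with ex1_root assms root_in_T snd_root show "x = root I U w" by blast
qed (simp add: level_eq snd_root)

text \<open>Lowering the threshold coarsens the equivalence, so a class at level
  \<open>Suc n\<close> lies inside one class at level \<open>n\<close> and is disjoint from all the
  others.\<close>

lemma ex1_pred:
  assumes "y \<in> T" and "y \<noteq> root I U w"
  shows "\<exists>!x. x \<in> T \<and> y \<in> succ x"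
proof -
  obtain E n where y: "y = (E, w (Suc n))" "E \<in> J_set I U (w (Suc n)) // J_rel I U (w (Suc n))"
    using assms root_iff by (metis T_cases not0_implies_Suc)
  let ?r = "J_rel I U (w n)"
  obtain i where i: "i \<in> J_set I U (w (Suc n))" "E = J_rel I U (w (Suc n)) `` {i}"
    using y(2) by (auto elim: quotientE)
  have le: "w n \<le> w (Suc n)" using strict_mono_less_eq[OF mono] by simp
  have iJ: "i \<in> J_set I U (w n)" using i(1) le by (auto simp: J_set_def)
  have iE: "i \<in> E" using i by (auto simp: J_rel_def J_set_def)
  have sub: "E \<subseteq> ?r `` {i}" using i(2) le by (auto simp: J_rel_def J_set_def)
  have lev_y: "lev y = Suc n" using y by (simp add: level_eq)
  have x: "(?r `` {i}, w n) \<in> T" using iJ by (simp add: in_T_iff quotientI)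
  show ?thesis
  proof (rule ex1I[of _ "(?r `` {i}, w n)"])
    show "(?r `` {i}, w n) \<in> T \<and> y \<in> succ (?r `` {i}, w n)"
      using x y iE sub assms lev_y by (auto simp: succs_iff[OF x] level_eq)
    fix x' assume x': "x' \<in> T \<and> y \<in> succ x'"
    then have "lev x' = n" "fst x' \<inter> E \<noteq> {}"
      using lev_y y(1) by (auto simp: succs_iff)
    with x' obtain F where F: "x' = (F, w n)" "F \<in> J_set I U (w n) // ?r" "F \<inter> E \<noteq> {}"
      by (metis T_cases fst_conv)
    then have "F \<inter> ?r `` {i} \<noteq> {}" using sub by blast
    then have "F = ?r `` {i}"
      using quotient_disj[OF equiv_J_rel F(2) quotientI[OF iJ]] by blast
    then show "x' = (?r `` {i}, w n)" using F(1) by simp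
  qed
qed

lemma root_no_pred: "x \<in> T \<Longrightarrow> root I U w \<notin> succ x"
  using root_iff[OF root_in_T] by (auto simp: succs_def)

section \<open>The q-matrix of the tree and its conservative completion\<close>

lemma Q_nonneg: "x \<noteq> y \<Longrightarrow> 0 \<le> Q x y"
  using gap_pos by (auto simp: Q_ext_def less_imp_le)

lemma Q_diag: "Q x x < 0"
proof -
  have "0 < inverse (gap w (lev x)) + real (card (succ x)) * inverse (gap w (Suc (lev x)))"
    using gap_pos by (intro add_pos_nonneg mult_nonneg_nonneg) (simp_all add: less_imp_le)
  then show ?thesis unfolding Q_ext_def by (simp add: succs_irrefl)
qed

text \<open>The vertex itself is included, so that this finite set carries the whole row of
  \<open>Q\<close>.\<close>

definition nbhd :: "'a vertex \<Rightarrow> 'a vertex set" where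
  "nbhd x = insert x (succ x \<union> {y \<in> T. x \<in> succ y})"

lemma finite_nbhd: assumes "x \<in> T" shows "finite (nbhd x)"
proof -
  have "finite {y \<in> T. x \<in> succ y}"
  proof (cases "x = root I U w")
    case False
    then obtain z where "{y \<in> T. x \<in> succ y} = {z}" using ex1_pred[OF assms False] by blast
    then show ?thesis by simp
  next
    case True
    then have "{y \<in> T. x \<in> succ y} = {}" using root_no_pred by blast
    then show ?thesis by (simp only: finite.emptyI)
  qed
  then show ?thesis by (simp add: nbhd_def finite_succs)
qed

lemma nbhd_subset: "x \<in> T \<Longrightarrow> nbhd x \<subseteq> T"
  by (auto simp: nbhd_def succs_def)

lemma Q_eq_0: "x \<in> T \<Longrightarrow> y \<in> T \<Longrightarrow> y \<notin> nbhd x \<Longrightarrow> Q x y = 0"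
  by (auto simp: Q_ext_def nbhd_def)

lemma nbhd_if_Q_neq_0: "x \<in> T \<Longrightarrow> y \<in> T \<Longrightarrow> Q x y \<noteq> 0 \<Longrightarrow> y \<in> nbhd x"
  using Q_eq_0 by blast

text \<open>The successors cancel against the diagonal, leaving the number of predecessors minus 1,
  divided by the gap. This is 0 off the root; the root has no predecessor and its gap is
  \<open>w 0\<close>.\<close>

lemma Q_row_sum:
  assumes "x \<in> T"
  shows "(\<Sum>y\<in>nbhd x. Q x y) = (if x = root I U w then - (1 / w 0) else 0)"
proof -
  let ?P = "{y \<in> T. x \<in> succ y}"
  have fin: "finite ?P" using finite_nbhd[OF assms] by (simp add: nbhd_def)
  have "(\<Sum>y\<in>nbhd x. Q x y) = Q x x + ((\<Sum>y\<in>succ x. Q x y) + (\<Sum>y\<in>?P. Q x y))"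
  proof -
    have "x \<notin> succ x \<union> ?P" "succ x \<inter> ?P = {}"
      using succs_irrefl succs_asym by blast+
    then show ?thesis
      unfolding nbhd_def using fin finite_succs
      by (simp add: sum.union_disjoint)
  qed
  also have "(\<Sum>y\<in>succ x. Q x y) = (\<Sum>y\<in>succ x. inverse (gap w (Suc (lev x))))"
    by (intro sum.cong) (auto simp: Q_ext_def succs_def)
  also have "(\<Sum>y\<in>?P. Q x y) = (\<Sum>y\<in>?P. inverse (gap w (lev x)))"
    using succs_asym by (intro sum.cong) (auto simp: Q_ext_def)
  also have "Q x x + ((\<Sum>y\<in>succ x. inverse (gap w (Suc (lev x)))) + (\<Sum>y\<in>?P. inverse (gap w (lev x)))) =
      (real (card ?P) - 1) * inverse (gap w (lev x))"
    by (simp add: Q_ext_def succs_irrefl algebra_simps)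
  also have "\<dots> = (if x = root I U w then - (1 / w 0) else 0)"
  proof (cases "x = root I U w")
    case True
    then have "?P = {}" using root_no_pred by blast
    then have "card ?P = 0" by (simp only: card.empty)
    then show ?thesis using True root_iff[OF assms] by (simp add: gap_def inverse_eq_divide)
  next
    case False
    then obtain z where "?P = {z}" using ex1_pred[OF assms False] by blast
    then have "card ?P = 1" by simp
    then show ?thesis using False by simp
  qed
  finally show ?thesis .
qed

lemma has_sum_Q:
  assumes "x \<in> T"
  shows "((\<lambda>y. Q x y * g y) has_sum (\<Sum>y\<in>nbhd x. Q x y * g y)) T"
  using finite_nbhd[OF assms] nbhd_subset[OF assms] assms
  by (intro has_sum_finite_neutralI) (simp_all add: Q_eq_0)

text \<open>A function vanishing at \<open>Absorbed\<close> does not see the absorption rate, so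
  results on the conservative chain transfer to \<open>Q\<close>.\<close>

lemma has_sum_chain_q_iff:
  assumes "g Absorbed = 0"
  shows "((\<lambda>y. chain_q I U w (Site x) y * g y) has_sum s) (chain_states I U) \<longleftrightarrow>
    ((\<lambda>y. Q x y * g (Site y)) has_sum s) T"
proof -
  have "((\<lambda>y. chain_q I U w (Site x) y * g y) has_sum s) (chain_states I U) \<longleftrightarrow>
      ((\<lambda>y. chain_q I U w (Site x) y * g y) has_sum s) (Site ` T)"
    using assms by (intro has_sum_cong_neutral) (auto simp: chain_states_def)
  also have "\<dots> \<longleftrightarrow> ((\<lambda>y. Q x y * g (Site y)) has_sum s) T"
    by (subst has_sum_reindex) (auto simp: inj_on_def o_def)
  finally show ?thesis .
qed

sublocale tree: finite_range_chain "chain_states I U" "chain_q I U w"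
proof
  show "countable (chain_states I U)"
    using countable_T by (simp add: chain_states_def)
next
  fix s assume s: "s \<in> chain_states I U"
  show "finite {y \<in> chain_states I U. chain_q I U w s y \<noteq> 0}"
  proof (cases s)
    case (Site x)
    then have "x \<in> T" using s by (auto simp: chain_states_def)
    then have "{y \<in> chain_states I U. chain_q I U w s y \<noteq> 0} \<subseteq> insert Absorbed (Site ` nbhd x)"
      using nbhd_if_Q_neq_0[of x] by (fastforce simp: chain_states_def Site)
    then show ?thesis by (rule finite_subset) (simp add: finite_nbhd \<open>x \<in> T\<close>)
  qed simp
  show "(chain_q I U w s has_sum 0) (chain_states I U)"
  proof (cases s)
    case (Site x)
    then have x: "x \<in> T" using s by (auto simp: chain_states_def)
    let ?B = "insert Absorbed (Site ` nbhd x)"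
    show ?thesis
    proof (rule has_sum_finite_neutralI)
      show "finite ?B" by (simp add: finite_nbhd[OF x])
      show "?B \<subseteq> chain_states I U"
        using nbhd_subset[OF x] by (auto simp: chain_states_def)
      have "(\<Sum>y\<in>?B. chain_q I U w s y) = chain_q I U w s Absorbed + (\<Sum>y\<in>Site ` nbhd x. chain_q I U w s y)"
        using finite_nbhd[OF x] by (intro sum.insert) auto
      also have "(\<Sum>y\<in>Site ` nbhd x. chain_q I U w s y) = (\<Sum>y\<in>nbhd x. Q x y)"
        by (subst sum.reindex) (simp_all add: inj_on_def Site)
      \<comment> \<open>The absorption rate is exactly the mass that \<open>Q_row_sum\<close> finds
        missing at the root.\<close>
      finally show "0 = (\<Sum>y\<in>?B. chain_q I U w s y)"
        by (simp add: Q_row_sum[OF x] Site)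
    next
      fix t assume "t \<in> chain_states I U - ?B"
      then obtain y where "t = Site y" "y \<in> T" "y \<notin> nbhd x"
        by (auto simp: chain_states_def)
      then show "chain_q I U w s t = 0"
        using Q_eq_0[OF x] Site by simp
    qed
  qed (simp add: has_sum_0)
  fix t assume "t \<in> chain_states I U" "s \<noteq> t"
  then show "0 \<le> chain_q I U w s t"
    using Q_nonneg w_pos[of 0] by (cases s; cases t) auto
qed

section \<open>The index set inside the tree\<close>

lemma vertex_of_in_T: "i \<in> I \<Longrightarrow> vertex_of I U i \<in> T"
  by (auto simp: vertex_of_def tree_ext_def matrix_values_def J_set_def intro!: quotientI)

text \<open>Equal vertices give \<open>U i i = U j j\<close> with this value at most
  \<open>U i j\<close>. As the diagonal dominates its row, the ultrametric inequality makes rows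
  \<open>i\<close> and \<open>j\<close> equal, against (H1).\<close>

lemma inj_on_vertex_of:
  assumes H1: "\<forall>i\<in>I. \<forall>j\<in>I. i \<noteq> j \<longrightarrow> (\<exists>k\<in>I. U i k \<noteq> U j k)"
  shows "inj_on (vertex_of I U) I"
proof (rule inj_onI, rule ccontr)
  fix i j assume ij: "i \<in> I" "j \<in> I" "vertex_of I U i = vertex_of I U j" "i \<noteq> j"
  have "j \<in> J_rel I U (U j j) `` {j}" using ij by (auto simp: J_rel_def J_set_def)
  then have diag: "U i i = U j j" and ge: "U i i \<le> U i j"
    using ij(3) by (auto simp: vertex_of_def J_rel_def)
  have bound: "U a k \<le> U a a" if "a \<in> I" "k \<in> I" for a k
    using U_min[of a a k] U_sym[of a k] that by auto
  have "U j k \<le> U i k" "U i k \<le> U j k" if "k \<in> I" for k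
    using U_min[OF ij(1) that ij(2)] U_min[OF ij(2) that ij(1)] U_sym[OF ij(1,2)]
      bound[OF ij(1) that] bound[OF ij(2) that] diag ge
    by (smt (verit))+
  then have "U i k = U j k" if "k \<in> I" for k
    using that by (intro antisym)
  then show False using H1 ij by blast
qed

end

section \<open>Harmonic extension from the index set\<close>

context ultrametric_tree
begin

abbreviation "V \<equiv> vertex_of I U"
abbreviation "exit_set \<equiv> insert Absorbed (Site ` V ` I)"

lemma rate_neg:
  assumes "s \<in> chain_states I U" "s \<notin> exit_set" shows "chain_q I U w s s < 0"
  using assms Q_diag by (auto simp: chain_states_def)

lemma Site_in_states: "x \<in> T \<Longrightarrow> Site x \<in> chain_states I U"
  by (simp add: chain_states_def)

text \<open>The row of \<open>Q\<close> has finite support, which makes the infinite sum finite, and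
  the hitting law at \<open>\<tau>\<close> becomes the exit law of the jump chain.\<close>

lemma Q_mat_eq:
  assumes "i \<in> I" "j \<in> I"
  shows "Q_mat I U w i j = Q (V i) (V j) +
    (\<Sum>k\<in>nbhd (V i) - V ` I. Q (V i) k * tree.exit_prob exit_set (Site k) (Site (V j)))"
proof -
  let ?f = "\<lambda>k. Q (V i) k * \<P>(\<omega> in tree_chain_space I U w. chain_at_tau I U w k \<omega> = Some (Site (V j)))"
  have x: "V i \<in> T" using assms by (simp add: vertex_of_in_T)
  have "(?f has_sum (\<Sum>k\<in>nbhd (V i) - V ` I. Q (V i) k * tree.exit_prob exit_set (Site k) (Site (V j))))
      (T - V ` I)"
  proof (rule has_sum_finite_neutralI)
    show "finite (nbhd (V i) - V ` I)" using finite_nbhd[OF x] by simp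
    show sub: "nbhd (V i) - V ` I \<subseteq> T - V ` I" using nbhd_subset[OF x] by blast
    show "?f k = 0" if "k \<in> (T - V ` I) - (nbhd (V i) - V ` I)" for k
    proof -
      have "Q (V i) k = 0" using that by (intro Q_eq_0 x) blast+
      then show ?thesis by simp
    qed
    show "(\<Sum>k\<in>nbhd (V i) - V ` I. Q (V i) k * tree.exit_prob exit_set (Site k) (Site (V j))) =
        (\<Sum>k\<in>nbhd (V i) - V ` I. ?f k)"
    proof (intro sum.cong refl arg_cong2[where f = "(*)"])
      fix k assume "k \<in> nbhd (V i) - V ` I"
      then have "Site k \<in> chain_states I U" using sub Site_in_states by blast
      then show "tree.exit_prob exit_set (Site k) (Site (V j)) =
          \<P>(\<omega> in tree_chain_space I U w. chain_at_tau I U w k \<omega> = Some (Site (V j)))"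
        unfolding chain_at_tau_def using assms(2) rate_neg
        by (intro tree.prob_chain_at_hit_time[symmetric]) auto
    qed
  qed
  then show ?thesis by (simp add: Q_mat_def infsumI)
qed

text \<open>First-step analysis applies to the conservative chain; the value 0 at
  \<open>Absorbed\<close> carries the result over to \<open>Q\<close>.\<close>

lemma exit_mean_harmonic_off_vertices:
  assumes x: "x \<in> T" "x \<notin> V ` I"
    and f: "f Absorbed = 0" "\<And>s. s \<in> exit_set \<Longrightarrow> \<bar>f s\<bar> \<le> C"
  shows "((\<lambda>y. Q x y * tree.exit_mean exit_set f (Site y)) has_sum 0) T"
proof -
  have s: "Site x \<in> chain_states I U" "Site x \<notin> exit_set"
    using x by (auto simp: Site_in_states)
  have "tree.exit_mean exit_set f (Site x) =
      (\<Sum>z\<in>tree.targets (Site x). jump_prob (chain_q I U w) (Site x) z * tree.exit_mean exit_set f z)"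
    using s f(2) by (rule tree.exit_mean_mean_value)
  moreover have "chain_q I U w (Site x) (Site x) \<noteq> 0"
    using rate_neg[OF s] by simp
  ultimately have "((\<lambda>y. chain_q I U w (Site x) y * tree.exit_mean exit_set f y) has_sum 0)
      (chain_states I U)"
    using tree.harmonic_iff_mean_value[OF s(1)] by blast
  moreover have "tree.exit_mean exit_set f Absorbed = 0"
    by (simp add: tree.exit_mean_start f(1))
  ultimately show ?thesis
    by (simp add: has_sum_chain_q_iff)
qed

lemma exit_mean_harmonic_on_vertices:
  assumes inj: "inj_on V I" and i: "i \<in> I"
    and f: "f Absorbed = 0" "\<And>s. s \<in> exit_set \<Longrightarrow> \<bar>f s\<bar> \<le> C" "\<And>j. j \<in> I \<Longrightarrow> f (Site (V j)) = h j"
    and h: "harmonic_on I (Q_mat I U w) h"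
  shows "((\<lambda>y. Q (V i) y * tree.exit_mean exit_set f (Site y)) has_sum 0) T"
proof -
  let ?u = "\<lambda>y. tree.exit_mean exit_set f (Site y)"
  let ?N = "nbhd (V i)" and ?e = "\<lambda>k j. tree.exit_prob exit_set (Site k) (Site (V j))"
  have x: "V i \<in> T" using i by (rule vertex_of_in_T)
  have u_V: "?u (V j) = h j" if "j \<in> I" for j
    using that by (simp add: tree.exit_mean_start f(3))
  have "((\<lambda>y. Q (V i) y * ?u y) has_sum (\<Sum>y\<in>?N \<inter> V ` I. Q (V i) y * ?u y)) (V ` I)"
    using finite_nbhd[OF x] vertex_of_in_T by (intro has_sum_finite_neutralI) (auto simp: Q_eq_0[OF x])
  then have "((\<lambda>j. Q (V i) (V j) * ?u (V j)) has_sum (\<Sum>y\<in>?N \<inter> V ` I. Q (V i) y * ?u y)) I"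
    by (simp add: has_sum_reindex[OF inj] o_def)
  then have 1: "((\<lambda>j. Q (V i) (V j) * h j) has_sum (\<Sum>y\<in>?N \<inter> V ` I. Q (V i) y * ?u y)) I"
    by (rule has_sum_cong[THEN iffD1, rotated]) (simp add: u_V)
  have 2: "((\<lambda>j. ?e k j * h j) has_sum ?u k) I" if k: "k \<in> ?N" for k
  proof -
    have "Site k \<in> chain_states I U"
      using k nbhd_subset[OF x] Site_in_states by blast
    then have "((\<lambda>s. tree.exit_prob exit_set (Site k) s * f s) has_sum ?u k) exit_set"
      using f(2) by (rule tree.exit_mean_has_sum)
    \<comment> \<open>The term at \<open>Absorbed\<close> drops out because \<open>f\<close> is 0
      there.\<close>
    then have "((\<lambda>s. tree.exit_prob exit_set (Site k) s * f s) has_sum ?u k) (Site ` V ` I)"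
      by (rule has_sum_cong_neutral[THEN iffD1, rotated -1]) (auto simp: f(1))
    moreover have "inj_on (\<lambda>j. Site (V j)) I"
      using inj by (auto simp: inj_on_def)
    ultimately have "((\<lambda>j. ?e k j * f (Site (V j))) has_sum ?u k) I"
      using has_sum_reindex[of "\<lambda>j. Site (V j)" I "\<lambda>s. tree.exit_prob exit_set (Site k) s * f s"]
      by (simp add: o_def image_image)
    then show ?thesis
      by (rule has_sum_cong[THEN iffD1, rotated]) (simp add: f(3))
  qed
  have "((\<lambda>j. Q (V i) (V j) * h j + (\<Sum>k\<in>?N - V ` I. Q (V i) k * (?e k j * h j))) has_sum
      (\<Sum>y\<in>?N \<inter> V ` I. Q (V i) y * ?u y) + (\<Sum>k\<in>?N - V ` I. Q (V i) k * ?u k)) I"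
    using 1 2 finite_nbhd[OF x] by (intro has_sum_add has_sum_sum has_sum_cmult_right) auto
  then have "((\<lambda>j. Q_mat I U w i j * h j) has_sum
      (\<Sum>y\<in>?N \<inter> V ` I. Q (V i) y * ?u y) + (\<Sum>k\<in>?N - V ` I. Q (V i) k * ?u k)) I"
    by (rule has_sum_cong[THEN iffD1, rotated])
       (simp add: Q_mat_eq[OF i] distrib_right sum_distrib_right mult.assoc)
  moreover have "((\<lambda>j. Q_mat I U w i j * h j) has_sum 0) I"
    using h i by (simp add: harmonic_on_def)
  ultimately have "(\<Sum>y\<in>?N \<inter> V ` I. Q (V i) y * ?u y) + (\<Sum>k\<in>?N - V ` I. Q (V i) k * ?u k) = 0"
    by (rule has_sum_unique)
  then have "(\<Sum>y\<in>?N. Q (V i) y * ?u y) = 0"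
    using sum.Int_Diff[OF finite_nbhd[OF x], of "\<lambda>y. Q (V i) y * ?u y" "V ` I"] by simp
  then show ?thesis using has_sum_Q[OF x, of ?u] by simp
qed

text \<open>The difference, set to 0 at \<open>Absorbed\<close>, is bounded, vanishes on
  \<open>exit_set\<close> and has the mean value property elsewhere, so
  \<open>tree.bounded_harmonic_eq_0\<close> applies.\<close>

lemma bounded_harmonic_determined:
  assumes hit: "\<forall>k\<in>T - V ` I. \<P>(\<omega> in tree_chain_space I U w. chain_at_tau I U w k \<omega> \<in> Some ` exit_set) = 1"
    and b: "bounded (f ` T)" "bounded (g ` T)"
    and harm: "harmonic_on T Q f" "harmonic_on T Q g"
    and eq: "\<And>i. i \<in> I \<Longrightarrow> f (V i) = g (V i)"
    and x: "x \<in> T"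
  shows "f x = g x"
proof -
  define d where "d s = (case s of Site y \<Rightarrow> f y - g y | Absorbed \<Rightarrow> 0)" for s
  obtain B C where B: "\<And>y. y \<in> T \<Longrightarrow> \<bar>f y\<bar> \<le> B" and C: "\<And>y. y \<in> T \<Longrightarrow> \<bar>g y\<bar> \<le> C"
    using b by (auto simp: bounded_iff)
  have "0 \<le> B + C" using B[OF x] C[OF x] by linarith
  have "d (Site x) = 0"
  proof (rule tree.bounded_harmonic_eq_0)
    show "Site x \<in> chain_states I U" using x by (rule Site_in_states)
    fix s assume s: "s \<in> chain_states I U"
    show "\<bar>d s\<bar> \<le> B + C"
    proof (cases s)
      case (Site y)
      then have "y \<in> T" using s by (auto simp: chain_states_def)
      then show ?thesis using B[of y] C[of y] Site by (simp add: d_def)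
    qed (use \<open>0 \<le> B + C\<close> in \<open>simp add: d_def\<close>)
    show "d s = 0" if "s \<in> exit_set"
      using that eq by (auto simp: d_def)
    assume off: "s \<notin> exit_set"
    with s obtain y where y: "s = Site y" "y \<in> T" "y \<notin> V ` I"
      by (auto simp: chain_states_def)
    show "\<P>(\<omega> in tree_chain_space I U w. chain_at (chain_q I U w) s \<omega>
        (hit_time (chain_q I U w) exit_set s \<omega>) \<in> Some ` exit_set) = 1"
      using hit y by (auto simp: chain_at_tau_def)
    have "((\<lambda>z. Q y z * f z + - (Q y z * g z)) has_sum 0 + - 0) T"
      using harm y(2) unfolding harmonic_on_def by (intro has_sum_add has_sum_uminusI) auto
    then have "((\<lambda>z. Q y z * d (Site z)) has_sum 0) T"
      by (simp add: d_def right_diff_distrib)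
    then have "((\<lambda>z. chain_q I U w s z * d z) has_sum 0) (chain_states I U)"
      by (simp add: has_sum_chain_q_iff y(1) d_def)
    then show "d s = (\<Sum>z\<in>tree.targets s. jump_prob (chain_q I U w) s z * d z)"
      using tree.harmonic_iff_mean_value[OF s] rate_neg[OF s off] by simp
  qed
  then show ?thesis by (simp add: d_def)
qed

end

text \<open>Membership in \<open>extensional\<close> fixes the values off the tree. Uniqueness is
  asserted among bounded functions, since the comparison with avoidance probabilities uses a uniform
  bound on the difference of two extensions.\<close>

theorem theorem5p2:
  fixes I :: "'a set" and U :: "'a \<Rightarrow> 'a \<Rightarrow> real" and w :: "nat \<Rightarrow> real" and h :: "'a \<Rightarrow> real"
  assumes ultrametric: "ultrametric_matrix I U"
    and H1: "\<forall>i\<in>I. \<forall>j\<in>I. i \<noteq> j \<longrightarrow> (\<exists>k\<in>I. U i k \<noteq> U j k)"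
    and H2: "matrix_values I U \<subseteq> {0<..}" "\<forall>x. \<not> x islimpt matrix_values I U"
    and enum: "strict_mono w" "range w = matrix_values I U"
    and H3: "\<forall>v\<in>matrix_values I U. finite (J_set I U v // J_rel I U v)"
    and transient: "transient_ext I U w"
    and H4: "\<forall>k\<in>tree_ext I U - vertex_of I U ` I.
               \<P>(\<omega> in tree_chain_space I U w.
                  chain_at_tau I U w k \<omega> \<in> Some ` (insert Absorbed (Site ` vertex_of I U ` I))) = 1"
    and h_bounded: "bounded (h ` I)"
    and h_harmonic: "harmonic_on I (Q_mat I U w) h"
  shows "\<exists>!ht. ht \<in> extensional (tree_ext I U) \<and>
               bounded (ht ` tree_ext I U) \<and>
               harmonic_on (tree_ext I U) (Q_ext I U w) ht \<and>
               (\<forall>i\<in>I. ht (vertex_of I U i) = h i)"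
proof -
  interpret ultrametric_tree I U w
    using ultrametric H2(1) enum H3 by unfold_locales auto
  have inj: "inj_on V I" using H1 by (rule inj_on_vertex_of)
  define f where "f s = (case s of Site x \<Rightarrow> h (inv_into I V x) | Absorbed \<Rightarrow> 0)" for s
  have f_Absorbed: "f Absorbed = 0" and f_V: "\<And>j. j \<in> I \<Longrightarrow> f (Site (V j)) = h j"
    using inj by (simp_all add: f_def)
  obtain C where C: "0 \<le> C" "\<And>j. j \<in> I \<Longrightarrow> \<bar>h j\<bar> \<le> C"
    using h_bounded by (auto simp: bounded_pos dest: less_imp_le)
  have f_bound: "\<bar>f s\<bar> \<le> C" if "s \<in> exit_set" for s
    using that C f_Absorbed f_V by auto
  define u where "u = restrict (\<lambda>x. tree.exit_mean exit_set f (Site x)) T"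
  show ?thesis
  proof (rule ex1I[of _ u], intro conjI ballI)
    show "u \<in> extensional T" by (simp add: u_def)
    have "\<bar>u x\<bar> \<le> C" if "x \<in> T" for x
    proof -
      have "\<bar>tree.exit_mean exit_set f (Site x)\<bar> \<le> C"
        using Site_in_states[OF that] f_bound C(1) by (rule tree.exit_mean_bound)
      then show ?thesis using that by (simp add: u_def)
    qed
    then show "bounded (u ` T)"
      by (auto simp: bounded_iff intro!: exI[of _ C])
    show "u (V i) = h i" if "i \<in> I" for i
      using that by (simp add: u_def vertex_of_in_T tree.exit_mean_start f_V)
    show "harmonic_on T Q u"
      unfolding harmonic_on_def
    proof
      fix x assume x: "x \<in> T"
      have "((\<lambda>y. Q x y * tree.exit_mean exit_set f (Site y)) has_sum 0) T"
      proof (cases "x \<in> V ` I")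
        case True
        then obtain i where i: "i \<in> I" "x = V i" by blast
        show ?thesis
          unfolding i(2) using inj i(1) f_Absorbed f_bound f_V h_harmonic
          by (rule exit_mean_harmonic_on_vertices)
      next
        case False
        with x show ?thesis
          using f_Absorbed f_bound by (rule exit_mean_harmonic_off_vertices)
      qed
      then show "((\<lambda>y. Q x y * u y) has_sum 0) T"
        by (rule has_sum_cong[THEN iffD1, rotated]) (simp add: u_def)
    qed
    fix g assume g: "g \<in> extensional T \<and> bounded (g ` T) \<and> harmonic_on T Q g \<and> (\<forall>i\<in>I. g (V i) = h i)"
    show "g = u"
    proof (rule extensionalityI)
      show "g \<in> extensional T" "u \<in> extensional T" using g by (simp_all add: u_def)
      show "g x = u x" if "x \<in> T" for x
      proof (rule bounded_harmonic_determined[OF H4])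
        show "bounded (g ` T)" "harmonic_on T Q g" using g by simp_all
        show "bounded (u ` T)" "harmonic_on T Q u" by fact+
        show "g (V i) = u (V i)" if "i \<in> I" for i
          using g \<open>\<And>i. i \<in> I \<Longrightarrow> u (V i) = h i\<close> that by simp
      qed fact
    qed
  qed
qed

end
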